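(* Let $\widetilde D$ be a connected extended coroot diagram with set of nodes $\widetilde\Delta^\vee$, let $\mathbf n:\widetilde\Delta\to\mathbf N$ be a function of the form $n_0\mathbf g$ for some positive integer $n_0$, where $\mathbf g(a)=g_a$ are the coroot integers, and let $k\ge1$ be an integer dividing at least one of the $\mathbf n(a)$. Let $\widetilde I(\mathbf n,k)=\{a\in\widetilde\Delta:k\nmid\mathbf n(a)\}$, let $\widetilde D'(\mathbf n,k)$ be the largest subdiagram of $\widetilde D$ having $\widetilde I^\vee(\mathbf n,k)$ as its set of nodes, and let $\ell:\widetilde\Delta^\vee\to\mathbf R^+$ be a length function for $\widetilde D$. Let $v\in\widetilde\Delta^\vee-\widetilde I^\vee(\mathbf n,k)$. Then exactly one of the following holds. (Type $\infty$) $v$ is the only element of $\widetilde\Delta^\vee-\widetilde I^\vee(\mathbf n,k)$. Or $v$ is not of Type $\infty$ and: (Type 1) $v$ is not connected by a bond of $\widetilde D$ to a node of $\widetilde D'(\mathbf n,k)$. (Type 2)(i) $v$ is connected by bonds of $\widetilde D$ to exactly two components of $\widetilde D'(\mathbf n,k)$, each of which is of type $A_1$, with nodes $v_1$ and $v_2$ say, and $\ell(v)\le\min(\ell(v_1),\ell(v_2))$. (Type 2)(ii) $v$ is connected by bonds of $\widetilde D$ to exactly one node $v_1$ of $\widetilde D'(\mathbf n,k)$, and $\ell(v)<\ell(v_1)$. (Type 3) $v$ is connected by bonds of $\widetilde D$ to exactly two components of $\widetilde D'(\mathbf n,k)$, each of which is of type $A_2$. (Type 4) $v$ is connected by bonds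 of $\widetilde D$ to exactly two components of $\widetilde D'(\mathbf n,k)$, and exactly one of the following holds: (i) both of these components are of type $A_1$, with nodes $v_1$ and $v_2$ say, and $\ell(v)>\min(\ell(v_1),\ell(v_2))$; (ii) each component is of type $A_3$; (iii) one component is of type $A_3$ and the other is of type $A_1$.
   Context: A connected extended coroot diagram is the extended coroot diagram of an irreducible, possibly non-reduced, root system $\Psi$: if $\Delta$ is a set of simple roots and $\tilde a$ is minus the highest root, put $\widetilde\Delta=\Delta\cup\{\tilde a\}$; the nodes are the coroots $\widetilde\Delta^\vee$ inverse to $\widetilde\Delta$, and distinct nodes $u,v$ are joined iff they are not orthogonal, by a bond of multiplicity $|u|^2/|v|^2$ where $|u|\ge|v|$, with an arrow toward the shorter one $v$ if the multiplicity exceeds one; $\widetilde A_1$ is drawn as two nodes joined by two single bonds. For a subset of $\widetilde\Delta$, the superscript $^\vee$ denotes the corresponding set of nodes. The coroot integers $g_a$ ($a\in\widetilde\Delta$) are the relatively prime positive integers with $\sum_{a\in\widetilde\Delta}g_aa^\vee=0$. A length function is a function $\ell:\widetilde\Delta^\vee\to\mathbf R^+$ such that if $v,v'$ are joined by a bond of $\widetilde D$ and $\ell(v)\ge\ell(v')$, then the multiplicity of the bond between $v$ and $v'$ is $\ell(v)^2/\ell(v')^2$ and the arrow (if the multiplicity is not one) points toward $v'$ (for $\widetilde A_1$, both nodes have the same length). *)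

theory Defs
  imports "HOL-Analysis.Analysis" "HOL-Library.Multiset"
begin

section \<open>Root systems\<close>

text \<open>Root systems live in a Euclidean space and are not required to be reduced. The coroot
  inverse to a root \<open>a\<close> is identified, via the inner product, with the vector \<open>2a / (a \<bullet> a)\<close>.\<close>

definition coroot :: "'a::euclidean_space \<Rightarrow> 'a" where
  "coroot a = (2 / (a \<bullet> a)) *\<^sub>R a"

definition root_system :: "'a::euclidean_space set \<Rightarrow> bool" where
  "root_system \<Psi> \<longleftrightarrow>
     finite \<Psi> \<and> 0 \<notin> \<Psi> \<and> span \<Psi> = UNIV \<and>
     (\<forall>a\<in>\<Psi>. \<forall>b\<in>\<Psi>. b - (b \<bullet> coroot a) *\<^sub>R a \<in> \<Psi>) \<and>
     (\<forall>a\<in>\<Psi>. \<forall>b\<in>\<Psi>. b \<bullet> coroot a \<in> \<int>)"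

definition irreducible_root_system :: "'a::euclidean_space set \<Rightarrow> bool" where
  "irreducible_root_system \<Psi> \<longleftrightarrow>
     root_system \<Psi> \<and> \<Psi> \<noteq> {} \<and>
     \<not> (\<exists>A B. A \<noteq> {} \<and> B \<noteq> {} \<and> A \<union> B = \<Psi> \<and> A \<inter> B = {} \<and>
             (\<forall>a\<in>A. \<forall>b\<in>B. a \<bullet> b = 0))"

definition simple_roots :: "'a::euclidean_space set \<Rightarrow> 'a set \<Rightarrow> bool" where
  "simple_roots \<Psi> \<Delta> \<longleftrightarrow>
     \<Delta> \<subseteq> \<Psi> \<and> independent \<Delta> \<and>
     (\<forall>b\<in>\<Psi>. \<exists>c::'a \<Rightarrow> nat. b = (\<Sum>a\<in>\<Delta>. real (c a) *\<^sub>R a) \<or> b = - (\<Sum>a\<in>\<Delta>. real (c a) *\<^sub>R a))"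

definition highest_root :: "'a::euclidean_space set \<Rightarrow> 'a set \<Rightarrow> 'a \<Rightarrow> bool" where
  "highest_root \<Psi> \<Delta> h \<longleftrightarrow>
     h \<in> \<Psi> \<and> (\<forall>b\<in>\<Psi>. \<exists>c::'a \<Rightarrow> nat. h - b = (\<Sum>a\<in>\<Delta>. real (c a) *\<^sub>R a))"

definition coroot_integers :: "'a::euclidean_space set \<Rightarrow> ('a \<Rightarrow> nat) \<Rightarrow> bool" where
  "coroot_integers E g \<longleftrightarrow>
     (\<forall>a\<in>E. 0 < g a) \<and> Gcd (g ` E) = 1 \<and> (\<Sum>a\<in>E. real (g a) *\<^sub>R coroot a) = 0"

section \<open>Diagrams\<close>

text \<open>\<open>bonds D u v\<close> is the multiset of the multiplicities of the bonds joining \<open>u\<close> and \<open>v\<close>: it is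
  empty if the nodes are not joined, and a singleton if they are joined by one bond, whatever
  the multiplicity of that bond. A larger multiset is needed only for the two single bonds of
  the extended diagram of \<open>A\<^sub>1\<close>. \<open>arrow D u v\<close> means that the bond between \<open>u\<close> and \<open>v\<close> carries
  an arrow pointing toward \<open>v\<close>.\<close>

record 'v diagram =
  nodes :: "'v set"
  bonds :: "'v \<Rightarrow> 'v \<Rightarrow> real multiset"
  arrow :: "'v \<Rightarrow> 'v \<Rightarrow> bool"

definition joined :: "'v diagram \<Rightarrow> 'v \<Rightarrow> 'v \<Rightarrow> bool" where
  "joined D u v \<longleftrightarrow> u \<in> nodes D \<and> v \<in> nodes D \<and> bonds D u v \<noteq> {#}"

text \<open>In the following definition, \<open>E\<close> is the set consisting of the simple roots and minus the
  highest root. Its coroots have the form \<open>{u, -u}\<close> exactly in the case of \<open>A\<^sub>1\<close>; for the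
  nonreduced system of rank 1 they are \<open>{-u, 2u}\<close>, joined by one bond of multiplicity 4.\<close>

definition coroot_diagram :: "'a::euclidean_space set \<Rightarrow> 'a diagram" where
  "coroot_diagram E =
    \<lparr> nodes = coroot ` E,
      bonds = (\<lambda>u v.
        if u \<notin> coroot ` E \<or> v \<notin> coroot ` E \<or> u = v \<or> u \<bullet> v = 0 then {#}
        else if coroot ` E = {u, - u} then {#1, 1#}
        else {# (max (norm u) (norm v))\<^sup>2 / (min (norm u) (norm v))\<^sup>2 #}),
      arrow = (\<lambda>u v. u \<in> coroot ` E \<and> v \<in> coroot ` E \<and> u \<bullet> v \<noteq> 0 \<and> norm v < norm u) \<rparr>"

definition subdiagram :: "'v diagram \<Rightarrow> 'v set \<Rightarrow> 'v diagram" where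
  "subdiagram D S =
    \<lparr> nodes = nodes D \<inter> S,
      bonds = (\<lambda>u v. if u \<in> S \<and> v \<in> S then bonds D u v else {#}),
      arrow = (\<lambda>u v. u \<in> S \<and> v \<in> S \<and> arrow D u v) \<rparr>"

text \<open>Components are represented by their sets of nodes.\<close>

definition diagram_components :: "'v diagram \<Rightarrow> 'v set set" where
  "diagram_components D = (\<lambda>u. {w \<in> nodes D. (joined D)\<^sup>*\<^sup>* u w}) ` nodes D"

definition type_A :: "nat \<Rightarrow> 'v diagram \<Rightarrow> bool" where
  "type_A n D \<longleftrightarrow>
     (\<exists>e. bij_betw e {..<n} (nodes D) \<and>
       (\<forall>i<n. \<forall>j<n. bonds D (e i) (e j) = (if i = Suc j \<or> j = Suc i then {#1#} else {#})))"

text \<open>For the extended diagram of \<open>A\<^sub>1\<close> all multiplicities are 1, so that this definition forces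
  the two nodes to have the same length.\<close>

definition length_function :: "'v diagram \<Rightarrow> ('v \<Rightarrow> real) \<Rightarrow> bool" where
  "length_function D \<l> \<longleftrightarrow>
     (\<forall>v\<in>nodes D. 0 < \<l> v) \<and>
     (\<forall>v\<in>nodes D. \<forall>v'\<in>nodes D. \<forall>m\<in>#bonds D v v'. \<l> v' \<le> \<l> v \<longrightarrow>
        m = (\<l> v)\<^sup>2 / (\<l> v')\<^sup>2 \<and> (m \<noteq> 1 \<longrightarrow> arrow D v v'))"

section \<open>Types of nodes\<close>

definition I_tilde :: "'a set \<Rightarrow> ('a \<Rightarrow> nat) \<Rightarrow> nat \<Rightarrow> 'a set" where
  "I_tilde E n k = {a \<in> E. \<not> k dvd n a}"

text \<open>In the following, \<open>D'\<close> is a full subdiagram of \<open>D\<close> and \<open>v\<close> is a node of \<open>D\<close> outside \<open>D'\<close>.\<close>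

definition adjacent_nodes :: "'v diagram \<Rightarrow> 'v diagram \<Rightarrow> 'v \<Rightarrow> 'v set" where
  "adjacent_nodes D D' v = {u \<in> nodes D'. joined D v u}"

definition adjacent_components :: "'v diagram \<Rightarrow> 'v diagram \<Rightarrow> 'v \<Rightarrow> 'v set set" where
  "adjacent_components D D' v = {C \<in> diagram_components D'. \<exists>u\<in>C. joined D v u}"

definition component_type_A :: "nat \<Rightarrow> 'v diagram \<Rightarrow> 'v set \<Rightarrow> bool" where
  "component_type_A n D' C \<longleftrightarrow> type_A n (subdiagram D' C)"

definition exactly_one :: "bool list \<Rightarrow> bool" where
  "exactly_one Ps \<longleftrightarrow> (\<exists>!i. i < length Ps \<and> Ps ! i)"

definition type_infinity :: "'v diagram \<Rightarrow> 'v diagram \<Rightarrow> 'v \<Rightarrow> bool" where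
  "type_infinity D D' v \<longleftrightarrow> nodes D - nodes D' = {v}"

definition type_1 :: "'v diagram \<Rightarrow> 'v diagram \<Rightarrow> 'v \<Rightarrow> bool" where
  "type_1 D D' v \<longleftrightarrow> \<not> type_infinity D D' v \<and> \<not> (\<exists>u\<in>nodes D'. joined D v u)"

definition type_2i :: "'v diagram \<Rightarrow> 'v diagram \<Rightarrow> ('v \<Rightarrow> real) \<Rightarrow> 'v \<Rightarrow> bool" where
  "type_2i D D' \<l> v \<longleftrightarrow> \<not> type_infinity D D' v \<and>
     (\<exists>C1 C2 v1 v2. C1 \<noteq> C2 \<and> adjacent_components D D' v = {C1, C2} \<and>
        component_type_A 1 D' C1 \<and> component_type_A 1 D' C2 \<and> v1 \<in> C1 \<and> v2 \<in> C2 \<and>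
        \<l> v \<le> min (\<l> v1) (\<l> v2))"

definition type_2ii :: "'v diagram \<Rightarrow> 'v diagram \<Rightarrow> ('v \<Rightarrow> real) \<Rightarrow> 'v \<Rightarrow> bool" where
  "type_2ii D D' \<l> v \<longleftrightarrow> \<not> type_infinity D D' v \<and>
     (\<exists>v1. adjacent_nodes D D' v = {v1} \<and> \<l> v < \<l> v1)"

definition type_3 :: "'v diagram \<Rightarrow> 'v diagram \<Rightarrow> 'v \<Rightarrow> bool" where
  "type_3 D D' v \<longleftrightarrow> \<not> type_infinity D D' v \<and>
     (\<exists>C1 C2. C1 \<noteq> C2 \<and> adjacent_components D D' v = {C1, C2} \<and>
        component_type_A 2 D' C1 \<and> component_type_A 2 D' C2)"

definition type_4 :: "'v diagram \<Rightarrow> 'v diagram \<Rightarrow> ('v \<Rightarrow> real) \<Rightarrow> 'v \<Rightarrow> bool" where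
  "type_4 D D' \<l> v \<longleftrightarrow> \<not> type_infinity D D' v \<and>
     (\<exists>C1 C2. C1 \<noteq> C2 \<and> adjacent_components D D' v = {C1, C2} \<and>
        exactly_one
          [component_type_A 1 D' C1 \<and> component_type_A 1 D' C2 \<and>
             (\<exists>v1\<in>C1. \<exists>v2\<in>C2. \<l> v > min (\<l> v1) (\<l> v2)),
           component_type_A 3 D' C1 \<and> component_type_A 3 D' C2,
           (component_type_A 3 D' C1 \<and> component_type_A 1 D' C2) \<or>
             (component_type_A 1 D' C1 \<and> component_type_A 3 D' C2)])"

end

(*
For nodes u, w let A u w be minus the Cartan integer 2 (u, w) / (w, w). Pairing the relation
between the coroots with a node w turns it into 2 g w = sum of A u w * g u over the neighbours u of w.
Hence g w <= 2 g u for joined u, w, and this leaves no room for branching at a node b with a larger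
neighbour: from there g descends in an arithmetic progression along a simple chain that ends in a leaf.

Let c be a node where g is maximal, g c = M. If a neighbour of c has the value M as well, then g takes
only the values M and M/2, where the nodes with value M/2 are leaves; as the coroot integers are
relatively prime, only k = 2 remains. Otherwise the diagram consists of c and the chains at c, their
weights A u c add up to 3 or 4, and the
values M (1 - 1/e) at the neighbours of c satisfy sum A (1 - 1/e) = 2. This gives a star with
all arms of length 1 and the graphs G2, F4, its dual, E6, E7 and E8, with explicit values of g.

The factor n0 is removed by passing from k to k / gcd k n0.
*)

theory Submission
  imports Defs
begin

section \<open>Harmonic functions on weighted graphs\<close>

text \<open>Where the equation comes from: along an arm at a strict maximum c, g falls by a constant
  drop d until it reaches d at the leaf. So M = e * d, where e counts the nodes of the arm including
  c. If the weights add up to 4, the bound g c <= 2 g u is attained at every neighbour and each e is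
  2. If they add up to 3, the equation becomes: the sum of A u c / e is 1. For three arms this is
  1/e1 + 1/e2 + 1/e3 = 1, solved by (3,3,3), (2,4,4) and (2,3,6), which are E6, E7 and E8. A weight
  2 or 3 merges equal arms: E6 gives \<open>shape_F\<close> and \<open>shape_G\<close>, E7 gives
  \<open>shape_F_dual\<close>. The types speak of components and lengths, whereas the graph knows
  only weights and values. \<open>local_shape\<close> is the interface between the two: lengths
  enter it only as a comparison of the two weights of a bond, and the choice between Types 2(i) and
  4(i) is left to the diagram side. That at most one type holds is read off from the definitions of
  the types.\<close>

locale harmonic_graph =
  fixes V :: "'v set" and A :: "'v \<Rightarrow> 'v \<Rightarrow> nat" and g :: "'v \<Rightarrow> nat"
  assumes finite_V: "finite V"
    and A_sym: "\<And>u v. u \<in> V \<Longrightarrow> v \<in> V \<Longrightarrow> A u v = 0 \<longleftrightarrow> A v u = 0"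
    and g_pos: "\<And>v. v \<in> V \<Longrightarrow> 0 < g v"
    and harmonic_V: "\<And>v. v \<in> V \<Longrightarrow> (\<Sum>u\<in>V. A u v * g u) = 2 * g v"
    and connected_V: "\<And>S. S \<subseteq> V \<Longrightarrow> S \<noteq> {} \<Longrightarrow>
      (\<And>u v. u \<in> V \<Longrightarrow> v \<in> S \<Longrightarrow> A u v \<noteq> 0 \<Longrightarrow> u \<in> S) \<Longrightarrow> S = V"
    and Gcd_g: "Gcd (g ` V) = 1"
begin

definition nb :: "'v \<Rightarrow> 'v set" where
  "nb v = {u \<in> V. A u v \<noteq> 0}"

lemma nb_V: "u \<in> nb v \<Longrightarrow> u \<in> V"
  by (simp add: nb_def)

lemma finite_nb [simp]: "finite (nb v)"
  using finite_V by (simp add: nb_def)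

lemma nb_sym: "v \<in> V \<Longrightarrow> u \<in> nb v \<Longrightarrow> v \<in> nb u"
  using A_sym [of u v] by (simp add: nb_def)

lemma nb_pos: "u \<in> nb v \<Longrightarrow> 1 \<le> A u v"
  by (simp add: nb_def)

lemma harmonic: "v \<in> V \<Longrightarrow> (\<Sum>u\<in>nb v. A u v * g u) = 2 * g v"
  by (subst harmonic_V [symmetric])
     (auto simp: nb_def intro!: sum.mono_neutral_left finite_V)

lemma harmonic_remove:
  assumes "v \<in> V" "u \<in> nb v"
  shows "A u v * g u + (\<Sum>w\<in>nb v - {u}. A w v * g w) = 2 * g v"
  using harmonic [OF assms(1)] sum.remove [OF finite_nb assms(2), of "\<lambda>w. A w v * g w"] by simp

lemma sum_zero_empty:
  assumes "S \<subseteq> nb v" "(\<Sum>u\<in>S. A u v * g u) = 0"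
  shows "S = {}"
proof (rule ccontr)
  assume "S \<noteq> {}"
  then obtain u where u: "u \<in> S" by blast
  have "finite S"
    using assms(1) finite_nb by (rule finite_subset)
  then have "A u v * g u = 0"
    using assms(2) u by simp
  then show False
    using u assms(1) g_pos [of u] by (auto simp: nb_def)
qed

section \<open>Descent of g along an arm\<close>

lemma half:
  assumes "v \<in> V" "u \<in> nb v"
  shows "g v \<le> 2 * g u"
proof -
  have "A v u * g v \<le> 2 * g u"
    using harmonic_remove [OF nb_V [OF assms(2)] nb_sym [OF assms]] by simp
  moreover have "1 \<le> A v u"
    using nb_pos [OF nb_sym [OF assms]] .
  ultimately show ?thesis
    by (metis dual_order.trans mult_le_mono1 nat_mult_1)
qed

lemma descending_weight:
  assumes "b \<in> V" "a \<in> nb b" "g b < g a"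
  shows "A a b = 1"
proof (rule ccontr)
  assume "A a b \<noteq> 1"
  then have "2 * g a \<le> A a b * g a"
    using nb_pos [OF assms(2)] by (intro mult_le_mono1) simp
  then show False
    using harmonic_remove [OF assms(1,2)] assms(3) by linarith
qed

text \<open>Every neighbour of \<open>b\<close> has at least half the value of \<open>b\<close>, so what is left of \<open>2 * g b\<close>
  after a larger neighbour suffices for at most one further neighbour.\<close>

lemma descend:
  assumes b: "b \<in> V" and a: "a \<in> nb b" and less: "g b < g a"
  obtains (leaf) "nb b = {a}" "g a = 2 * g b"
  | (step) w where "w \<noteq> a" "nb b = {a, w}" "A w b = 1" "A b w = 1" "g w + g a = 2 * g b"
proof -
  have sum: "g a + (\<Sum>u\<in>nb b - {a}. A u b * g u) = 2 * g b"
    using harmonic_remove [OF b a] descending_weight [OF assms] by simp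
  show thesis
  proof (cases "nb b - {a} = {}")
    case True
    then have "nb b = {a}"
      using a by blast
    moreover have "g a = 2 * g b"
      using sum True by simp
    ultimately show thesis
      by (rule leaf)
  next
    case False
    then obtain w where w: "w \<in> nb b" "w \<noteq> a" by auto
    have rest: "A w b * g w + (\<Sum>u\<in>nb b - {a} - {w}. A u b * g u) = (\<Sum>u\<in>nb b - {a}. A u b * g u)"
      using w by (subst sum.remove [of "nb b - {a}" w]) auto
    have "nb b - {a} - {w} = {}"
    proof (rule ccontr)
      assume "nb b - {a} - {w} \<noteq> {}"
      then obtain x where x: "x \<in> nb b" "x \<noteq> a" "x \<noteq> w" by auto
      have "A x b * g x \<le> (\<Sum>u\<in>nb b - {a} - {w}. A u b * g u)"
        using x by (intro member_le_sum) auto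
      moreover have "g x \<le> A x b * g x" "g w \<le> A w b * g w"
        using nb_pos x w by auto
      ultimately show False
        using half [OF b x(1)] half [OF b w(1)] sum rest less by linarith
    qed
    note none = this
    have nb: "nb b = {a, w}"
      using none a w by blast
    have val: "A w b * g w + g a = 2 * g b"
      using rest sum unfolding none by simp
    have "A w b = 1"
    proof (rule ccontr)
      assume "A w b \<noteq> 1"
      then have "2 * g w \<le> A w b * g w"
        using nb_pos [OF w(1)] by (intro mult_le_mono1) simp
      then show False
        using half [OF b w(1)] val less by linarith
    qed
    moreover from this have "A b w = 1"
      using descending_weight [OF nb_V [OF w(1)] nb_sym [OF b w(1)]] val less by simp
    ultimately show thesis
      using step w(2) nb val by simp
  qed
qed

text \<open>The relation g w + g a = 2 g b hands the drop g a - g b on unchanged to the next node,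
  and at the leaf the drop equals g b itself. This makes the numbers e at a strict maximum
  integers.\<close>

lemma drop_dvd:
  assumes "b \<in> V" "a \<in> nb b" "g b < g a"
  shows "(g a - g b) dvd g b"
  using assms
proof (induction "g b" arbitrary: a b rule: less_induct)
  case less
  from less.prems show ?case
  proof (cases rule: descend)
    case leaf
    then show ?thesis by simp
  next
    case (step w)
    have "g w < g b" "g b - g w = g a - g b"
      using step less.prems by auto
    then have "(g a - g b) dvd g w" "g b = g w + (g a - g b)"
      using less.hyps [of w b] step less.prems nb_sym nb_V
      by (metis insertI1 insert_commute, linarith)
    then show ?thesis
      by (metis dvd_add dvd_refl)
  qed
qed

text \<open>A further node would have the value 2 g b - g a = 0.\<close>

lemma arm_end:
  assumes "b \<in> V" "a \<in> nb b" "g a = 2 * g b"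
  shows "nb b = {a}"
proof -
  have "g b < g a"
    using g_pos assms by simp
  with assms(1,2) show ?thesis
  proof (cases rule: descend)
    case (step w)
    then have "w \<in> V" "g w = 0"
      using assms(3) nb_V by auto
    then show ?thesis
      using g_pos [of w] by simp
  qed
qed

lemma arm_step:
  assumes "b \<in> V" "a \<in> nb b" "g b < g a" "g a < 2 * g b"
  obtains w where "w \<in> V" "w \<noteq> a" "nb b = {a, w}" "b \<in> nb w"
    "A w b = 1" "A b w = 1" "g w = 2 * g b - g a"
  using assms(1-3)
proof (cases rule: descend)
  case leaf
  then show thesis using assms by simp
next
  case (step w)
  then show thesis
    using that [of w] nb_sym [OF assms(1), of w] nb_V [of w b] by simp
qed

text \<open>Connectedness in the form in which it is used: an explicit list of nodes that contains
  all neighbours of its members is the whole graph.\<close>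

lemma closed_eq_V:
  assumes "S \<subseteq> V" "S \<noteq> {}" "\<And>v. v \<in> S \<Longrightarrow> nb v \<subseteq> S"
  shows "S = V"
  using assms by (intro connected_V) (auto simp: nb_def)

lemma common_dvd:
  assumes "\<And>v. v \<in> V \<Longrightarrow> t dvd g v"
  shows "t = 1"
proof -
  have "t dvd Gcd (g ` V)"
    using assms by (intro Gcd_greatest) auto
  then show ?thesis
    using Gcd_g by simp
qed

section \<open>Neighbourhoods of a node after removal of the values divisible by k\<close>

definition I_nb :: "nat \<Rightarrow> 'v \<Rightarrow> 'v set" where
  "I_nb k v = {u \<in> nb v. \<not> k dvd g u}"

text \<open>\<open>chain1\<close>, \<open>chain2\<close> and \<open>chain3\<close> describe whole
  components of types A1, A2 and A3, since all neighbours not divisible by k are prescribed. In the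
  longer chains each node lies in \<open>I_nb\<close> of another one, so it is not divisible by k;
  for \<open>chain1\<close> this has to come from elsewhere.\<close>

definition chain1 :: "nat \<Rightarrow> 'v set \<Rightarrow> bool" where
  "chain1 k C \<longleftrightarrow> (\<exists>x. C = {x} \<and> I_nb k x = {})"

definition chain2 :: "nat \<Rightarrow> 'v set \<Rightarrow> bool" where
  "chain2 k C \<longleftrightarrow> (\<exists>x y. C = {x, y} \<and> I_nb k x = {y} \<and> I_nb k y = {x} \<and>
     x \<noteq> y \<and> A x y = 1 \<and> A y x = 1)"

definition chain3 :: "nat \<Rightarrow> 'v set \<Rightarrow> bool" where
  "chain3 k C \<longleftrightarrow> (\<exists>x y z. C = {x, y, z} \<and> I_nb k x = {y} \<and> I_nb k y = {x, z} \<and> I_nb k z = {y} \<and>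
     x \<noteq> y \<and> y \<noteq> z \<and> x \<noteq> z \<and> A x y = 1 \<and> A y x = 1 \<and> A y z = 1 \<and> A z y = 1)"

text \<open>The condition that a is not in C2 keeps the two components apart.\<close>

definition two_chains :: "nat \<Rightarrow> 'v \<Rightarrow> 'v set \<Rightarrow> 'v set \<Rightarrow> bool" where
  "two_chains k v C1 C2 \<longleftrightarrow> (\<exists>a b. I_nb k v = {a, b} \<and> a \<in> C1 \<and> b \<in> C2 \<and> a \<notin> C2)"

text \<open>The first three alternatives lead to Types infinity, 1 and 2(ii), where A v a < A a v
  says that a is longer than v. The pairs of chains lead to Type 2(i) or 4(i), Type 3, Type 4(ii)
  and Type 4(iii), in this order.\<close>

definition local_shape :: "nat \<Rightarrow> 'v \<Rightarrow> bool" where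
  "local_shape k v \<longleftrightarrow>
     (\<forall>u\<in>V. k dvd g u \<longrightarrow> u = v) \<or>
     I_nb k v = {} \<or>
     (\<exists>a. I_nb k v = {a} \<and> A v a < A a v) \<or>
     (\<exists>C1 C2. two_chains k v C1 C2 \<and>
       (chain1 k C1 \<and> chain1 k C2 \<or> chain2 k C1 \<and> chain2 k C2 \<or>
        chain3 k C1 \<and> chain3 k C2 \<or> chain3 k C1 \<and> chain1 k C2))"

lemma local_shape_infinity: "(\<And>u. u \<in> V \<Longrightarrow> k dvd g u \<Longrightarrow> u = v) \<Longrightarrow> local_shape k v"
  by (simp add: local_shape_def)

lemma local_shape_1: "I_nb k v = {} \<Longrightarrow> local_shape k v"
  by (simp add: local_shape_def)

lemma local_shape_2ii: "I_nb k v = {a} \<Longrightarrow> A v a < A a v \<Longrightarrow> local_shape k v"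
  by (simp add: local_shape_def)

lemma local_shape_11:
  assumes "I_nb k v = {a, b}" "a \<noteq> b" "I_nb k a = {}" "I_nb k b = {}"
  shows "local_shape k v"
proof -
  have "two_chains k v {a} {b}" "chain1 k {a}" "chain1 k {b}"
    using assms by (auto simp: two_chains_def chain1_def)
  then show ?thesis
    unfolding local_shape_def by blast
qed

lemma local_shape_22:
  assumes "I_nb k v = {a, b}" "a \<noteq> b" "a \<noteq> b'"
    and "I_nb k a = {a'}" "I_nb k a' = {a}" "a \<noteq> a'" "A a a' = 1" "A a' a = 1"
    and "I_nb k b = {b'}" "I_nb k b' = {b}" "b \<noteq> b'" "A b b' = 1" "A b' b = 1"
  shows "local_shape k v"
proof -
  have "two_chains k v {a, a'} {b, b'}"
    using assms by (auto simp: two_chains_def)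
  moreover have "chain2 k {a, a'}" "chain2 k {b, b'}"
    unfolding chain2_def using assms by blast+
  ultimately show ?thesis
    unfolding local_shape_def by blast
qed

text \<open>A neighbour of equal value already uses up half of the total 2 M at a node of maximal
  value. What remains allows another node of value M or leaves of value M/2, but no longer
  descent.\<close>

lemma local_shape_plateau:
  assumes c: "c \<in> V" "\<And>u. u \<in> V \<Longrightarrow> g u \<le> g c" and c': "c' \<in> nb c" "g c' = g c"
    and v: "v \<in> V" "k dvd g v" "2 \<le> k"
  shows "local_shape k v"
proof -
  define M where "M = g c"
  define P where "P = {v \<in> V. g v = M \<and> (\<exists>u\<in>nb v. g u = M)}"
  have "c \<in> P"
    unfolding P_def M_def using c(1) c' by blast
  have P_nb: "u \<in> P \<or> 2 * g u = M \<and> nb u = {v}" if v: "v \<in> P" and u: "u \<in> nb v" for u v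
  proof (cases "g u = M")
    case True
    moreover have "g v = M" "v \<in> nb u" "u \<in> V"
      using v u nb_sym nb_V by (simp_all add: P_def)
    ultimately show ?thesis
      unfolding P_def by blast
  next
    case False
    obtain w where w: "w \<in> nb v" "g w = M" and gv: "g v = M" "v \<in> V"
      using v by (auto simp: P_def)
    have less: "g u < g v" and uV: "u \<in> V"
      using False c(2) nb_V [OF u] gv by (auto simp: M_def le_neq_implies_less)
    from uV nb_sym [OF gv(2) u] less show ?thesis
    proof (cases rule: descend)
      case leaf
      then show ?thesis using gv by simp
    next
      \<comment> \<open>If u is not a leaf, then 2 g u = g x + M, so g u exceeds M/2. Now w and u
        alone cannot give exactly 2 M: with weights 1 because g u < M, and with a larger weight
        because the sum becomes too big. A further neighbour y brings at least M/2, which is again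
        too much.\<close>
      case (step x)
      have gx: "0 < g x"
        using step nb_V g_pos by blast
      have uw: "u \<noteq> w"
        using False w by auto
      have eq: "A w v * M + (A u v * g u + (\<Sum>x\<in>nb v - {w} - {u}. A x v * g x)) = 2 * M"
        using harmonic_remove [OF gv(2) w(1)] u uw w gv
        by (subst sum.remove [symmetric, of "nb v - {w}" u]) auto
      have Aw: "M \<le> A w v * M" "g u \<le> A u v * g u"
        using nb_pos w(1) u by auto
      have "\<exists>x. x \<in> nb v - {w} - {u}"
      proof (rule ccontr)
        assume "\<not> ?thesis"
        then have "nb v - {w} - {u} = {}" by blast
        then have e: "A w v * M + A u v * g u = 2 * M"
          using eq by (simp only: sum.empty add_0_right)
        show False
        proof (cases "A w v = 1 \<and> A u v = 1")
          case True
          then show ?thesis using e False by simp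
        next
          case nt: False
          have "2 * M \<le> A w v * M \<or> 2 * g u \<le> A u v * g u"
            using nt nb_pos [OF w(1)] nb_pos [OF u]
            by (metis Suc_1 Suc_leI le_neq_implies_less mult_le_mono1 One_nat_def)
          then show ?thesis
            using e Aw gx step gv less g_pos [OF uV] by linarith
        qed
      qed
      then obtain y where y: "y \<in> nb v" "y \<noteq> w" "y \<noteq> u" by auto
      have "A y v * g y \<le> (\<Sum>x\<in>nb v - {w} - {u}. A x v * g x)"
        using y by (intro member_le_sum) auto
      moreover have "g y \<le> A y v * g y"
        using nb_pos y by auto
      ultimately show ?thesis
        using half [OF gv(2) y(1)] eq Aw gx step gv by linarith
    qed
  qed
  define H where "H = {u \<in> V. 2 * g u = M \<and> (\<exists>v\<in>P. nb u = {v})}"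
  have "P \<union> H = V"
  proof (rule closed_eq_V)
    show "nb v \<subseteq> P \<union> H" if "v \<in> P \<union> H" for v
      using that P_nb nb_V by (fastforce simp: H_def)
  qed (use \<open>c \<in> P\<close> in \<open>auto simp: P_def H_def\<close>)
  then have V_cases: "g u = M \<and> u \<in> P \<or> 2 * g u = M \<and> u \<in> H" if "u \<in> V" for u
    using that by (auto simp: P_def H_def)
  \<comment> \<open>Without leaves of value M/2 all values are M, hence 1, and k >= 2 divides none
    of them. Otherwise M/2 divides all values and must be 1.\<close>
  have M2: "M = 2"
  proof (cases "H = {}")
    case True
    then have "M = 1"
      using V_cases by (intro common_dvd) auto
    then show ?thesis
      using V_cases [OF v(1)] v True dvd_imp_le [OF v(2)] by auto
  next
    case False
    then obtain m where m: "M = 2 * m" by (auto simp: H_def)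
    have "m = 1"
      using V_cases by (intro common_dvd) (force simp: m)
    then show ?thesis using m by simp
  qed
  have gv: "g v = 2" and vP: "v \<in> P" and k: "k = 2"
  proof -
    have "k \<le> g v"
      using v g_pos by (intro dvd_imp_le) auto
    then show "g v = 2" "v \<in> P"
      using V_cases [OF v(1)] v(3) M2 by auto
    then show "k = 2"
      using \<open>k \<le> g v\<close> v(3) by simp
  qed
  obtain w where w: "w \<in> nb v" "g w = 2"
    using vP M2 by (auto simp: P_def)
  have leaf: "g a = 1 \<and> nb a = {v} \<and> A v a = 1 \<and> I_nb k a = {}" if a: "a \<in> I_nb k v" for a
  proof -
    have aV: "a \<in> nb v" "odd (g a)"
      using a k by (auto simp: I_nb_def)
    have nba: "nb a = {v}" "g a = 1"
      using P_nb [OF vP aV(1)] aV(2) M2 by (auto simp: P_def)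
    then show ?thesis
      using harmonic [OF nb_V [OF aV(1)]] gv k by (auto simp: I_nb_def)
  qed
  show ?thesis
  proof (cases "I_nb k v = {}")
    case True
    then show ?thesis by (rule local_shape_1)
  next
    case False
    then obtain a where a: "a \<in> I_nb k v" by blast
    have aw: "a \<noteq> w" "a \<in> nb v"
      using leaf [OF a] w a by (auto simp: I_nb_def)
    have eq: "A w v * 2 + (A a v + (\<Sum>x\<in>nb v - {w} - {a}. A x v * g x)) = 4"
      using harmonic_remove [OF v(1) w(1)] w gv leaf [OF a] aw
        sum.remove [of "nb v - {w}" a "\<lambda>x. A x v * g x"] by auto
    \<comment> \<open>Of the total 4 the node w takes 2. The remaining 2 is shared by two leaves of
      weight 1, giving two components A1, or comes from one leaf of weight 2, giving Type
      2(ii).\<close>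
    have Aw: "A w v = 1"
      using eq nb_pos [OF w(1)] nb_pos [OF aw(2)] by linarith
    show ?thesis
    proof (cases "A a v = 1")
      case True
      then have one: "(\<Sum>x\<in>nb v - {w} - {a}. A x v * g x) = 1"
        using eq Aw by simp
      then have "nb v - {w} - {a} \<noteq> {}"
        by (metis sum.empty zero_neq_one)
      then obtain b where b: "b \<in> nb v - {w} - {a}" by auto
      have rest: "A b v * g b + (\<Sum>x\<in>nb v - {w} - {a} - {b}. A x v * g x) = 1"
        using one b sum.remove [of "nb v - {w} - {a}" b "\<lambda>x. A x v * g x"] by simp
      have "1 \<le> A b v" "0 < g b"
        using b nb_pos nb_V g_pos by auto
      then have "A b v * g b = 1" and z: "(\<Sum>x\<in>nb v - {w} - {a} - {b}. A x v * g x) = 0"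
        using rest by (simp_all add: add_is_1)
      have "nb v - {w} - {a} - {b} = {}"
        using z by (intro sum_zero_empty) auto
      then have "nb v = {w, a, b}"
        using w aw b by auto
      then have "I_nb k v = {a, b}"
        using k w leaf [OF a] \<open>A b v * g b = 1\<close> by (auto simp: I_nb_def)
      then show ?thesis
        using local_shape_11 [of k v a b] leaf b by auto
    next
      case False
      then have "(\<Sum>x\<in>nb v - {w} - {a}. A x v * g x) = 0" "1 < A a v"
        using eq Aw nb_pos [OF aw(2)] by linarith+
      then have "nb v - {w} - {a} = {}"
        by (intro sum_zero_empty) auto
      then have "I_nb k v = {a}"
        using a w k by (auto simp: I_nb_def)
      then show ?thesis
        using local_shape_2ii [of k v a] leaf [OF a] \<open>1 < A a v\<close> by simp
    qed
  qed
qed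

subsection \<open>The exceptional graphs\<close>

text \<open>The number in \<open>arm_1\<close>, \<open>arm_2\<close>, \<open>arm_3\<close>,
  \<open>arm_5\<close> is e - 1, the number of nodes beyond the centre a. The values e = 2, 3, 4, 6
  are those that occur in the solutions of the equation at a strict maximum; 5 does not.\<close>

lemma arm_1:
  assumes "b \<in> V" "a \<in> nb b" "g b = t" "g a = 2 * t"
  shows "nb b = {a}"
  using assms by (intro arm_end) simp_all

lemma arm_2:
  assumes "b \<in> V" "a \<in> nb b" "g b = 2 * t" "g a = 3 * t" "0 < t"
  obtains w where "w \<in> V" "w \<noteq> a" "nb b = {a, w}" "nb w = {b}" "A w b = 1" "A b w = 1" "g w = t"
proof -
  have "g b < g a" "g a < 2 * g b"
    using assms by simp_all
  with assms(1,2) obtain w where w: "w \<in> V" "w \<noteq> a" "nb b = {a, w}" "b \<in> nb w"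
    "A w b = 1" "A b w = 1" "g w = 2 * g b - g a"
    by (rule arm_step)
  moreover from this have gw: "g w = t"
    using assms by simp
  moreover have "nb w = {b}"
    using w(1,4) gw assms(3) by (rule arm_1)
  ultimately show thesis
    by (intro that)
qed

lemma arm_3:
  assumes "b \<in> V" "a \<in> nb b" "g b = 3 * t" "g a = 4 * t" "0 < t"
  obtains w x where "w \<in> V" "w \<noteq> a" "nb b = {a, w}" "A w b = 1" "A b w = 1" "g w = 2 * t"
    "x \<in> V" "x \<noteq> b" "nb w = {b, x}" "nb x = {w}" "A x w = 1" "A w x = 1" "g x = t"
proof -
  have "g b < g a" "g a < 2 * g b"
    using assms by simp_all
  with assms(1,2) obtain w where w: "w \<in> V" "w \<noteq> a" "nb b = {a, w}" "b \<in> nb w"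
    "A w b = 1" "A b w = 1" "g w = 2 * g b - g a"
    by (rule arm_step)
  then have gw: "g w = 2 * t"
    using assms by simp
  obtain x where "x \<in> V" "x \<noteq> b" "nb w = {b, x}" "nb x = {w}" "A x w = 1" "A w x = 1" "g x = t"
    using w(1,4) gw assms(3,5) by (rule arm_2)
  with w gw show thesis
    by (intro that)
qed

lemma arm_5:
  assumes "b \<in> V" "a \<in> nb b" "g b = 5 * t" "g a = 6 * t" "0 < t"
  obtains w x y z where
    "w \<in> V" "w \<noteq> a" "nb b = {a, w}" "A w b = 1" "A b w = 1" "g w = 4 * t"
    "x \<in> V" "x \<noteq> b" "nb w = {b, x}" "A x w = 1" "A w x = 1" "g x = 3 * t"
    "y \<in> V" "y \<noteq> w" "nb x = {w, y}" "A y x = 1" "A x y = 1" "g y = 2 * t"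
    "z \<in> V" "z \<noteq> x" "nb y = {x, z}" "nb z = {y}" "A z y = 1" "A y z = 1" "g z = t"
proof -
  have "g b < g a" "g a < 2 * g b"
    using assms by simp_all
  with assms(1,2) obtain w where w: "w \<in> V" "w \<noteq> a" "nb b = {a, w}" "b \<in> nb w"
    "A w b = 1" "A b w = 1" "g w = 2 * g b - g a"
    by (rule arm_step)
  then have gw: "g w = 4 * t"
    using assms by simp
  then have "g w < g b" "g b < 2 * g w"
    using assms by simp_all
  with w(1,4) obtain x where x: "x \<in> V" "x \<noteq> b" "nb w = {b, x}" "w \<in> nb x"
    "A x w = 1" "A w x = 1" "g x = 2 * g w - g b"
    by (rule arm_step)
  then have gx: "g x = 3 * t"
    using gw assms by simp
  obtain y z where "y \<in> V" "y \<noteq> w" "nb x = {w, y}" "A y x = 1" "A x y = 1" "g y = 2 * t"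
    "z \<in> V" "z \<noteq> x" "nb y = {x, z}" "nb z = {y}" "A z y = 1" "A y z = 1" "g z = t"
    using x(1,4) gx gw assms(5) by (rule arm_3)
  with w gw x gx show thesis
    by (intro that)
qed

lemma dvd_le_6:
  fixes k m :: nat
  assumes "k dvd m" "0 < m" "m \<le> 6" "2 \<le> k"
  shows "k \<in> {2, 3, 4, 5, 6}"
  using assms dvd_imp_le [of k m] by auto

text \<open>All lemmas on exceptional graphs follow one scheme: the arms produce the nodes, their
  list is closed under \<open>nb\<close> and hence is V, then t = 1 and finitely many k remain.
  Repetitions in the list are harmless, so distinctness is proved only where the chains need it.
  Here the values are 3, 2, 1, and each k >= 2 divides at most one of them.\<close>

lemma shape_G:
  assumes c: "c \<in> V" "nb c = {u}" "g c = 3 * t" "g u = 2 * t" "0 < t"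
    and v: "v \<in> V" "k dvd g v" "2 \<le> k"
  shows "local_shape k v"
proof -
  have u: "u \<in> V" "c \<in> nb u"
    using c nb_V nb_sym by auto
  obtain w where w: "w \<in> V" "nb u = {c, w}" "nb w = {u}" "g w = t"
    using u c(4,3,5) by (rule arm_2)
  have V: "V = {c, u, w}"
    using c u w by (intro closed_eq_V [symmetric]) auto
  have t: "t = 1"
    using c w by (intro common_dvd) (auto simp: V)
  have k: "k \<in> {2, 3, 4, 5, 6}"
    using v c w t by (intro dvd_le_6 [of k "g v"]) (auto simp: V)
  show ?thesis
    using k v c w t by (intro local_shape_infinity) (auto simp: V)
qed

text \<open>The values are 3 at c and 2, 1 on each arm, so for k = 2 the remaining nodes are
  pairwise not joined. The weights are irrelevant for components with one node.\<close>

lemma shape_F: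
  assumes c: "c \<in> V" "nb c = {x, y}" "x \<noteq> y" "g c = 3 * t" "g x = 2 * t" "g y = 2 * t" "0 < t"
    and v: "v \<in> V" "k dvd g v" "2 \<le> k"
  shows "local_shape k v"
proof -
  have xy: "x \<in> V" "c \<in> nb x" "y \<in> V" "c \<in> nb y"
    using c nb_V [of x c] nb_V [of y c] nb_sym [of c] by auto
  obtain x' where x': "x' \<in> V" "x' \<noteq> c" "nb x = {c, x'}" "nb x' = {x}" "g x' = t"
    using xy(1,2) c(5,4,7) by (rule arm_2)
  obtain y' where y': "y' \<in> V" "y' \<noteq> c" "nb y = {c, y'}" "nb y' = {y}" "g y' = t"
    using xy(3,4) c(6,4,7) by (rule arm_2)
  have V: "V = {c, x, y, x', y'}"
    using c xy x' y' by (intro closed_eq_V [symmetric]) auto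
  have t: "t = 1"
    using c x' y' by (intro common_dvd) (auto simp: V)
  note g = c(4-6)[unfolded t, simplified] x'(5)[unfolded t] y'(5)[unfolded t]
  have k: "k = 2 \<and> v \<in> {x, y} \<or> k = 3 \<and> v = c"
    using dvd_le_6 [of k "g v"] v g by (auto simp: V)
  have I_nb: "I_nb 2 x = {c, x'}" "I_nb 2 y = {c, y'}" "I_nb 2 c = {}" "I_nb 2 x' = {}" "I_nb 2 y' = {}"
    unfolding I_nb_def c(2) x'(3,4) y'(3,4) using g by auto
  show ?thesis
    using k
  proof (elim disjE conjE)
    assume "k = 2" "v \<in> {x, y}"
    then show ?thesis
      using local_shape_11 [OF I_nb(1)] local_shape_11 [OF I_nb(2)] I_nb x' y' by auto
  next
    assume "k = 3" "v = c"
    then show ?thesis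
      using g by (intro local_shape_infinity) (auto simp: V)
  qed
qed

text \<open>The values are 4 at c, then 3, 2, 1 on one arm and 2 on the other. For k = 2 the centre
  keeps the single neighbour x, and A c x < A x c makes this Type 2(ii).\<close>

lemma shape_F_dual:
  assumes c: "c \<in> V" "nb c = {x, y}" "A c x < A x c"
      "g c = 4 * t" "g x = 3 * t" "g y = 2 * t" "0 < t"
    and v: "v \<in> V" "k dvd g v" "2 \<le> k"
  shows "local_shape k v"
proof -
  have xy: "x \<in> V" "c \<in> nb x" "y \<in> V" "c \<in> nb y"
    using c nb_V [of x c] nb_V [of y c] nb_sym [of c] by auto
  obtain x' x'' where x': "x' \<in> V" "nb x = {c, x'}" "g x' = 2 * t"
      "x'' \<in> V" "x'' \<noteq> x" "nb x' = {x, x''}" "nb x'' = {x'}" "g x'' = t"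
    using xy(1,2) c(5,4,7) by (rule arm_3)
  have y: "nb y = {c}"
    using xy(3,4) c(6,4) by (intro arm_1 [of _ _ "2 * t"]) auto
  have V: "V = {c, x, y, x', x''}"
    using c xy x' y by (intro closed_eq_V [symmetric]) auto
  have t: "t = 1"
    using c x' by (intro common_dvd) (auto simp: V)
  note g = c(4-6)[unfolded t, simplified] x'(3,8)[unfolded t, simplified]
  have k: "k = 2 \<and> v \<in> {c, y, x'} \<or> k = 3 \<and> v = x \<or> k = 4 \<and> v = c"
    using dvd_le_6 [of k "g v"] v g by (auto simp: V)
  have I_nb: "I_nb 2 c = {x}" "I_nb 2 y = {}" "I_nb 2 x' = {x, x''}" "I_nb 2 x = {}" "I_nb 2 x'' = {}"
    unfolding I_nb_def c(2) x'(2,6,7) y using g by auto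
  show ?thesis
    using k
  proof (elim disjE conjE)
    assume "k = 2" "v \<in> {c, y, x'}"
    then show ?thesis
      using local_shape_11 [OF I_nb(3)] local_shape_2ii [OF I_nb(1)] local_shape_1 [OF I_nb(2)] I_nb x' c
      by auto
  qed (use g in \<open>intro local_shape_infinity; auto simp: V\<close>)+
qed

lemma shape_E6:
  assumes c: "c \<in> V" "nb c = {x, y, z}" "g c = 3 * t"
      "g x = 2 * t" "g y = 2 * t" "g z = 2 * t" "0 < t"
    and v: "v \<in> V" "k dvd g v" "2 \<le> k"
  shows "local_shape k v"
proof -
  have xyz: "x \<in> V" "c \<in> nb x" "y \<in> V" "c \<in> nb y" "z \<in> V" "c \<in> nb z"
    using c nb_V [of x c] nb_V [of y c] nb_V [of z c] nb_sym [of c] by auto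
  obtain x' where x': "x' \<in> V" "x' \<noteq> c" "nb x = {c, x'}" "nb x' = {x}" "g x' = t"
    using xyz(1,2) c(4,3,7) by (rule arm_2)
  obtain y' where y': "y' \<in> V" "y' \<noteq> c" "nb y = {c, y'}" "nb y' = {y}" "g y' = t"
    using xyz(3,4) c(5,3,7) by (rule arm_2)
  obtain z' where z': "z' \<in> V" "z' \<noteq> c" "nb z = {c, z'}" "nb z' = {z}" "g z' = t"
    using xyz(5,6) c(6,3,7) by (rule arm_2)
  have V: "V = {c, x, y, z, x', y', z'}"
    using c xyz x' y' z' by (intro closed_eq_V [symmetric]) auto
  have t: "t = 1"
    using c x' y' z' by (intro common_dvd) (auto simp: V)
  note g = c(3-6)[unfolded t, simplified] x'(5)[unfolded t] y'(5)[unfolded t] z'(5)[unfolded t]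
  have k: "k = 2 \<and> v \<in> {x, y, z} \<or> k = 3 \<and> v = c"
    using dvd_le_6 [of k "g v"] v g by (auto simp: V)
  have I_nb: "I_nb 2 x = {c, x'}" "I_nb 2 y = {c, y'}" "I_nb 2 z = {c, z'}"
    "I_nb 2 c = {}" "I_nb 2 x' = {}" "I_nb 2 y' = {}" "I_nb 2 z' = {}"
    unfolding I_nb_def c(2) x'(3,4) y'(3,4) z'(3,4) using g by auto
  show ?thesis
    using k
  proof (elim disjE conjE)
    assume "k = 2" "v \<in> {x, y, z}"
    then show ?thesis
      using local_shape_11 [OF I_nb(1)] local_shape_11 [OF I_nb(2)] local_shape_11 [OF I_nb(3)]
        I_nb x' y' z' by auto
  next
    assume "k = 3" "v = c"
    then show ?thesis
      using g by (intro local_shape_infinity) (auto simp: V)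
  qed
qed

text \<open>For k = 3 the nodes y and z are removed, which leaves three pairs: c with the short arm
  x, and the outer two nodes of each long arm. This is a source of Type 3, and the weights are
  needed to recognise type A2.\<close>

lemma shape_E7:
  assumes c: "c \<in> V" "nb c = {x, y, z}" "y \<noteq> z" "A c y = 1" "A y c = 1" "A c z = 1" "A z c = 1"
      "g c = 4 * t" "g x = 2 * t" "g y = 3 * t" "g z = 3 * t" "0 < t"
    and Ax: "A c x = 1" "A x c = 1"
    and v: "v \<in> V" "k dvd g v" "2 \<le> k"
  shows "local_shape k v"
proof -
  have xyz: "x \<in> V" "c \<in> nb x" "y \<in> V" "c \<in> nb y" "z \<in> V" "c \<in> nb z"
    using c nb_V [of x c] nb_V [of y c] nb_V [of z c] nb_sym [of c] by auto
  have x: "nb x = {c}"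
    using xyz(1,2) c by (intro arm_1 [of _ _ "2 * t"]) auto
  obtain y' y'' where y': "y' \<in> V" "nb y = {c, y'}" "A y' y = 1" "A y y' = 1" "g y' = 2 * t"
      "y'' \<in> V" "y'' \<noteq> y" "nb y' = {y, y''}" "nb y'' = {y'}" "A y'' y' = 1" "A y' y'' = 1" "g y'' = t"
    using xyz(3,4) c(10,8,12) by (rule arm_3)
  obtain z' z'' where z': "z' \<in> V" "nb z = {c, z'}" "A z' z = 1" "A z z' = 1" "g z' = 2 * t"
      "z'' \<in> V" "z'' \<noteq> z" "nb z' = {z, z''}" "nb z'' = {z'}" "A z'' z' = 1" "A z' z'' = 1" "g z'' = t"
    using xyz(5,6) c(11,8,12) by (rule arm_3)
  have V: "V = {c, x, y, z, y', z', y'', z''}"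
    using c x xyz y' z' by (intro closed_eq_V [symmetric]) auto
  have t: "t = 1"
    using c y' z' by (intro common_dvd) (auto simp: V)
  note g = c(8-11)[unfolded t, simplified] y'(5,12)[unfolded t, simplified]
    z'(5,12)[unfolded t, simplified]
  note nb = c(2) x y'(2,8,9) z'(2,8,9)
  have k: "k = 2 \<and> v \<in> {c, x, y', z'} \<or> k = 3 \<and> v \<in> {y, z} \<or> k = 4 \<and> v = c"
    using dvd_le_6 [of k "g v"] v g by (auto simp: V)
  have I_nb2: "I_nb 2 c = {y, z}" "I_nb 2 x = {}" "I_nb 2 y' = {y, y''}" "I_nb 2 z' = {z, z''}"
    "I_nb 2 y = {}" "I_nb 2 z = {}" "I_nb 2 y'' = {}" "I_nb 2 z'' = {}"
    unfolding I_nb_def nb using g by auto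
  have I_nb3: "I_nb 3 y = {y', c}" "I_nb 3 z = {z', c}" "I_nb 3 c = {x}" "I_nb 3 x = {c}"
    "I_nb 3 y' = {y''}" "I_nb 3 y'' = {y'}" "I_nb 3 z' = {z''}" "I_nb 3 z'' = {z'}"
    unfolding I_nb_def nb using g by auto
  have ne: "y' \<noteq> c" "y' \<noteq> y''" "z' \<noteq> c" "z' \<noteq> z''" "c \<noteq> x" "c \<noteq> y''" "c \<noteq> z''"
    using g by auto
  \<comment> \<open>Here x and y' have the same value 2, as has z'. They are told apart by the
    values of their neighbours: c for x, and y'' or z'' for the others.\<close>
  then have ne': "y' \<noteq> x" "z' \<noteq> x"
    using I_nb3(4,5,7) by auto
  show ?thesis
    using k
  proof (elim disjE conjE)
    assume "k = 2" "v \<in> {c, x, y', z'}"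
    then show ?thesis
      using local_shape_11 [OF I_nb2(1)] local_shape_11 [OF I_nb2(3)] local_shape_11 [OF I_nb2(4)]
        local_shape_1 [OF I_nb2(2)] I_nb2 y' z' c by auto
  next
    assume k: "k = 3" and v: "v \<in> {y, z}"
    have "local_shape 3 y"
      by (rule local_shape_22 [of 3 y y' c x y'']) (use I_nb3 ne ne' y' Ax in simp_all)
    moreover have "local_shape 3 z"
      by (rule local_shape_22 [of 3 z z' c x z'']) (use I_nb3 ne ne' z' Ax in simp_all)
    ultimately show ?thesis
      using k v by auto
  next
    assume "k = 4" "v = c"
    then show ?thesis
      using g by (intro local_shape_infinity) (auto simp: V)
  qed
qed

text \<open>The names z4, ..., z1 carry the values of g. For k = 4 the nodes y and z4 are removed,
  leaving the chains x, c, z and z3, z2, z1 and the single node y'. So z4 is of Type 4(ii) and y of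
  Type 4(iii).\<close>

lemma shape_E8:
  assumes c: "c \<in> V" "nb c = {x, y, z}"
      "g c = 6 * t" "g x = 3 * t" "g y = 4 * t" "g z = 5 * t" "0 < t"
    and A: "A c x = 1" "A x c = 1" "A c z = 1" "A z c = 1"
    and v: "v \<in> V" "k dvd g v" "2 \<le> k"
  shows "local_shape k v"
proof -
  have xyz: "x \<in> V" "c \<in> nb x" "y \<in> V" "c \<in> nb y" "z \<in> V" "c \<in> nb z"
    using c nb_V [of x c] nb_V [of y c] nb_V [of z c] nb_sym [of c] by auto
  have x: "nb x = {c}"
    using xyz(1,2) c by (intro arm_1 [of _ _ "3 * t"]) auto
  obtain y' where y': "y' \<in> V" "y' \<noteq> c" "nb y = {c, y'}" "nb y' = {y}"
      "A y' y = 1" "A y y' = 1" "g y' = 2 * t"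
    by (rule arm_2 [OF xyz(3,4), of "2 * t"]) (use c in auto)
  obtain z4 z3 z2 z1 where z4: "z4 \<in> V" "z4 \<noteq> c" "nb z = {c, z4}" "A z4 z = 1" "A z z4 = 1" "g z4 = 4 * t"
    and z3: "z3 \<in> V" "z3 \<noteq> z" "nb z4 = {z, z3}" "A z3 z4 = 1" "A z4 z3 = 1" "g z3 = 3 * t"
    and z2: "z2 \<in> V" "z2 \<noteq> z4" "nb z3 = {z4, z2}" "A z2 z3 = 1" "A z3 z2 = 1" "g z2 = 2 * t"
    and z1: "z1 \<in> V" "z1 \<noteq> z3" "nb z2 = {z3, z1}" "nb z1 = {z2}" "A z1 z2 = 1" "A z2 z1 = 1" "g z1 = t"
    using xyz(5,6) c(6,3,7) by (rule arm_5)
  have V: "V = {c, x, y, z, y', z4, z3, z2, z1}"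
    using c x xyz y' z4 z3 z2 z1 by (intro closed_eq_V [symmetric]) auto
  have t: "t = 1"
    using c y' z4 z3 z2 z1 by (intro common_dvd) (auto simp: V)
  note g = c(3-6)[unfolded t, simplified] y'(7)[unfolded t, simplified]
    z4(6)[unfolded t, simplified] z3(6)[unfolded t, simplified]
    z2(6)[unfolded t, simplified] z1(7)[unfolded t, simplified]
  note nb = c(2) x y'(3,4) z4(3) z3(3) z2(3) z1(3,4)
  have k: "k = 2 \<and> v \<in> {c, y, y', z4, z2} \<or> k = 3 \<and> v \<in> {c, x, z3} \<or> k = 4 \<and> v \<in> {y, z4} \<or>
      k = 5 \<and> v = z \<or> k = 6 \<and> v = c"
    using dvd_le_6 [of k "g v"] v g by (auto simp: V)
  have I_nb2: "I_nb 2 c = {x, z}" "I_nb 2 y = {}" "I_nb 2 y' = {}" "I_nb 2 z4 = {z, z3}" "I_nb 2 z2 = {z3, z1}"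
    "I_nb 2 x = {}" "I_nb 2 z = {}" "I_nb 2 z3 = {}" "I_nb 2 z1 = {}"
    unfolding I_nb_def nb using g by auto
  have I_nb3: "I_nb 3 c = {y, z}" "I_nb 3 x = {}" "I_nb 3 z3 = {z4, z2}" "I_nb 3 y = {y'}" "I_nb 3 y' = {y}"
    "I_nb 3 z = {z4}" "I_nb 3 z4 = {z}" "I_nb 3 z2 = {z1}" "I_nb 3 z1 = {z2}"
    unfolding I_nb_def nb using g by auto
  have I_nb4: "I_nb 4 y = {c, y'}" "I_nb 4 z4 = {z, z3}" "I_nb 4 y' = {}" "I_nb 4 x = {c}" "I_nb 4 c = {x, z}"
    "I_nb 4 z = {c}" "I_nb 4 z3 = {z2}" "I_nb 4 z2 = {z3, z1}" "I_nb 4 z1 = {z2}"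
    unfolding I_nb_def nb using g by auto
  have ne: "x \<noteq> z" "z \<noteq> z3" "z3 \<noteq> z1" "y \<noteq> z" "z4 \<noteq> z2" "y \<noteq> y'" "y' \<noteq> z" "z \<noteq> z4" "z2 \<noteq> z1"
    "z4 \<noteq> z1" "c \<noteq> y'" "c \<noteq> x" "c \<noteq> z" "z3 \<noteq> z2" "z \<noteq> z2" "z \<noteq> z1"
    using g by auto
  \<comment> \<open>Both nodes have value 4; they are separated by their neighbours y' of value 2
    and z of value 5.\<close>
  then have ne': "y \<noteq> z4"
    using I_nb3(4,7) by auto
  show ?thesis
    using k
  proof (elim disjE conjE)
    assume "k = 2" "v \<in> {c, y, y', z4, z2}"
    then show ?thesis
      using local_shape_11 [OF I_nb2(1)] local_shape_11 [OF I_nb2(4)] local_shape_11 [OF I_nb2(5)]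
        local_shape_1 [OF I_nb2(2)] local_shape_1 [OF I_nb2(3)] I_nb2 ne by auto
  next
    assume k: "k = 3" and v: "v \<in> {c, x, z3}"
    have "local_shape 3 c"
      by (rule local_shape_22 [of 3 c y z z4 y']) (use I_nb3 ne ne' y' z4 in simp_all)
    moreover have "local_shape 3 z3"
      by (rule local_shape_22 [of 3 z3 z4 z2 z1 z]) (use I_nb3 ne z4 z1 in simp_all)
    ultimately show ?thesis
      using k v local_shape_1 [OF I_nb3(2)] by auto
  next
    assume k: "k = 4" and v: "v \<in> {y, z4}"
    have chains: "chain3 4 {x, c, z}" "chain3 4 {z3, z2, z1}" "chain1 4 {y'}"
      unfolding chain3_def chain1_def using I_nb4 ne A z2 z1 by blast+
    have "two_chains 4 y {x, c, z} {y'}" "two_chains 4 z4 {x, c, z} {z3, z2, z1}"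
      unfolding two_chains_def using I_nb4 ne by blast+
    then show ?thesis
      using k v chains unfolding local_shape_def by blast
  qed (use g in \<open>intro local_shape_infinity; auto simp: V\<close>)+
qed

end

subsection \<open>Arms at a strict maximum\<close>

text \<open>In terms of M = e * (M - a) = f * (M - b) the equation is 2/e + 1/f = 1, with the
  solutions (3,3) and (4,2).\<close>

lemma two_arms:
  fixes a b M :: nat
  assumes "2 * a + b = 2 * M" "a < M" "b < M" "(M - a) dvd a" "(M - b) dvd b"
  shows "\<exists>t>0. M = 3 * t \<and> a = 2 * t \<and> b = 2 * t \<or> M = 4 * t \<and> a = 3 * t \<and> b = 2 * t"
proof -
  define p q where "p = M - a" and "q = M - b"
  have p: "0 < p" "M = a + p" and q: "0 < q" "M = b + q"
    using assms by (auto simp: p_def q_def)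
  obtain s r where s: "a = p * s" and r: "b = q * r"
    using assms by (auto simp: p_def q_def dvd_def)
  have qp: "q + p = p * s"
    using assms(1) p q s by linarith
  \<comment> \<open>Here s = e - 1 and r = f - 1. The positive drop q = p * (s - 1) forces s >= 2,
    so after the shift s = s' + 2 the equation is a product of natural numbers without
    subtraction.\<close>
  then obtain s' where s': "s = Suc (Suc s')"
    using q p by (cases s; cases "s - 1") auto
  have q_eq: "q = p * Suc s'"
    using qp s' by simp
  have "p * (Suc (Suc s')) + p = p * Suc s' * r + p * Suc s'"
    using p q s r s' q_eq by simp
  then have "p * (s' + 3) = p * (Suc s' * Suc r)"
    by (simp add: algebra_simps)
  then have eq: "s' + 3 = Suc s' * Suc r"
    using p(1) by (metis mult_cancel1 not_gr_zero)
  have "s' \<le> 1 \<and> 1 \<le> r"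
  proof (cases "r = 0")
    case False
    then have "Suc s' * 2 \<le> Suc s' * Suc r"
      by (intro mult_le_mono2) simp
    then show ?thesis using eq False by simp
  qed (use eq in simp)
  then have "s' = 0 \<or> s' = 1" by linarith
  then have "s' = 0 \<and> r = 2 \<or> s' = 1 \<and> r = 1"
    using eq by auto
  then show ?thesis
    using p q s r s' q_eq by (intro exI [of _ p]) auto
qed

text \<open>The equation 1/e1 + 1/e2 + 1/e3 = 1 for sorted arms. The largest drop p is at least M/3,
  which bounds the first denominator by 3; the second is then bounded in the same way, and the last
  drop is what remains of M. In the proof e and f are the denominators minus 1.\<close>

lemma three_arms:
  fixes a b c M :: nat
  assumes "a + b + c = 2 * M" "a \<le> b" "b \<le> c" "c < M" "(M - a) dvd a" "(M - b) dvd b"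
  shows "\<exists>t>0. M = 3 * t \<and> a = 2 * t \<and> b = 2 * t \<and> c = 2 * t \<or>
    M = 4 * t \<and> a = 2 * t \<and> b = 3 * t \<and> c = 3 * t \<or>
    M = 6 * t \<and> a = 3 * t \<and> b = 4 * t \<and> c = 5 * t"
proof -
  define p q r where "p = M - a" and "q = M - b" and "r = M - c"
  have p: "M = a + p" and q: "M = b + q" and r: "0 < r" "M = c + r"
    and le: "r \<le> q" "q \<le> p"
    using assms by (auto simp: p_def q_def r_def)
  have sum: "p + q + r = M"
    using assms(1) p q r by linarith
  obtain e f where e: "a = p * e" and f: "b = q * f"
    using assms by (auto simp: p_def q_def dvd_def)
  have "e \<noteq> 0"
    using e p sum r by (intro notI) auto
  moreover have "e \<le> 2"
  proof (rule ccontr)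
    assume "\<not> e \<le> 2"
    then have "p * 3 \<le> a"
      unfolding e by (intro mult_le_mono2) simp
    then show False using p sum le r by linarith
  qed
  ultimately consider "e = 1" | "e = 2" by linarith
  then show ?thesis
  proof cases
    case 2
    then have "a = 2 * p"
      using e by simp
    then have "q = p" "r = p"
      using p sum le by linarith+
    then show ?thesis
      using r p q e 2 by (intro exI [of _ p]) auto
  next
    case 1
    then have "a = p"
      using e by simp
    then have qr: "p = q + r" "M = 2 * p"
      using p sum by linarith+
    have "2 \<le> f"
    proof (rule ccontr)
      assume "\<not> 2 \<le> f"
      then have "b \<le> q * 1"
        unfolding f by (intro mult_le_mono2) simp
      then show False using qr q r by linarith
    qed
    moreover have "f \<le> 3"
    proof (rule ccontr)
      assume "\<not> f \<le> 3"
      then have "q * 4 \<le> b"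
        unfolding f by (intro mult_le_mono2) simp
      then show False using qr q le r by linarith
    qed
    ultimately have "f = 2 \<or> f = 3" by linarith
    then show ?thesis
    proof
      assume "f = 2"
      then have "b = 2 * q"
        using f by simp
      then have "M = 6 * r" "a = 3 * r" "b = 4 * r" "c = 5 * r"
        using q r(2) p qr by linarith+
      then show ?thesis
        using r(1) by blast
    next
      assume "f = 3"
      then have "b = 3 * q"
        using f by simp
      then have "M = 4 * r" "a = 2 * r" "b = 3 * r" "c = 3 * r"
        using q r(2) p qr by linarith+
      then show ?thesis
        using r(1) by blast
    qed
  qed
qed

section \<open>Strict maxima and the local shape of an arbitrary node\<close>

context harmonic_graph
begin

text \<open>The total weight W at c is pinned down by M/2 <= g u < M: the weighted sum 2 M gives 2 <
  W <= 4.\<close>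

lemma local_shape_peak:
  assumes c: "c \<in> V" "\<And>u. u \<in> nb c \<Longrightarrow> g u < g c"
    and v: "v \<in> V" "k dvd g v" "2 \<le> k"
  shows "local_shape k v"
proof -
  have nb: "u \<in> V" "c \<in> nb u" "A c u = 1" "(g c - g u) dvd g u" "1 \<le> A u c" "g c \<le> 2 * g u"
    if "u \<in> nb c" for u
    using that nb_V nb_sym [OF c(1)] descending_weight [of u c] drop_dvd [of u c] nb_pos
      c(2) [of u] half [OF c(1), of u] by blast+
  have sum: "(\<Sum>u\<in>nb c. A u c * g u) = 2 * g c"
    using c(1) by (rule harmonic)
  have pos: "0 < g c"
    using c(1) g_pos by simp
  define W where "W = (\<Sum>u\<in>nb c. A u c)"
  have ge: "(\<Sum>u\<in>nb c. A u c * g c) \<le> (\<Sum>u\<in>nb c. A u c * (2 * g u))"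
    using nb by (intro sum_mono mult_le_mono2) auto
  have sum2: "(\<Sum>u\<in>nb c. A u c * (2 * g u)) = 4 * g c"
  proof -
    have "(\<Sum>u\<in>nb c. A u c * (2 * g u)) = 2 * (\<Sum>u\<in>nb c. A u c * g u)"
      by (simp add: sum_distrib_left mult.left_commute)
    then show ?thesis using sum by simp
  qed
  have W: "(\<Sum>u\<in>nb c. A u c * g c) = W * g c"
    by (simp add: W_def sum_distrib_right)
  have W4: "W \<le> 4"
    using ge sum2 W pos by simp
  have "nb c \<noteq> {}"
    using sum pos by auto
  then have "(\<Sum>u\<in>nb c. A u c * g u) < (\<Sum>u\<in>nb c. A u c * g c)"
    using c(2) nb by (intro sum_strict_mono) (auto simp: Suc_le_eq)
  then have W3: "2 < W"
    using W sum by simp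
  show ?thesis
  proof (cases "W = 4")
    case True
    have eq: "2 * g u = g c" if "u \<in> nb c" for u
    proof -
      \<comment> \<open>For W = 4 two sums with termwise ordered entries coincide, so the entries
        coincide.\<close>
      have "A u c * g c = A u c * (2 * g u)"
        using nb that W sum2 True
        by (intro sum_mono_inv [of "\<lambda>u. A u c * g c" "nb c" "\<lambda>u. A u c * (2 * g u)"]) auto
      then show ?thesis
        using nb(5) [OF that] by simp
    qed
    have leaf: "nb u = {c}" if "u \<in> nb c" for u
      using nb [OF that] eq [OF that] by (intro arm_end) auto
    have V: "V = insert c (nb c)"
      using c(1) leaf nb(1) by (intro closed_eq_V [symmetric]) auto
    obtain u where u: "u \<in> nb c"
      using \<open>nb c \<noteq> {}\<close> by auto
    have same: "g c = 2 * g u" "g x = g u" if "x \<in> nb c" for x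
      using eq [OF u] eq [OF that] by linarith+
    have "g u = 1"
    proof (rule common_dvd)
      fix x assume "x \<in> V"
      then have "x = c \<or> x \<in> nb c"
        using V by blast
      then show "g u dvd g x"
        using same [OF u] same(2) by auto
    qed
    then have one: "g x = 1" if "x \<in> nb c" for x
      using same(2) [OF that] by simp
    have div: "x = c" if "x \<in> V" "k dvd g x" for x
    proof (rule ccontr)
      assume "x \<noteq> c"
      then have "g x = 1"
        using that(1) V one by blast
      then show False
        using that(2) v(3) by simp
    qed
    show ?thesis
      using div div [OF v(1,2)] by (intro local_shape_infinity) simp
  next
    case False
    then have W: "(\<Sum>u\<in>nb c. A u c) = 3"
      using W3 W4 by (simp add: W_def)
    have "(\<Sum>u\<in>nb c. 1) \<le> (\<Sum>u\<in>nb c. A u c)"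
      using nb by (intro sum_mono) auto
    then have "card (nb c) \<le> 3" "card (nb c) \<noteq> 0"
      using W \<open>nb c \<noteq> {}\<close> by auto
    then consider "card (nb c) = 1" | "card (nb c) = 2" | "card (nb c) = 3" by linarith
    then show ?thesis
    proof cases
      case 1
      then obtain u where u: "nb c = {u}"
        by (auto simp: card_1_singleton_iff)
      then have gu: "3 * g u = 2 * g c"
        using W sum by simp
      \<comment> \<open>With one neighbour of weight 3 the equation is 3/e = 1, and t is the
        drop.\<close>
      define t where "t = g c - g u"
      have "g c = 3 * t" "g u = 2 * t" "0 < t"
        using gu pos by (auto simp: t_def)
      then show ?thesis
        using c(1) u v by (intro shape_G)
    next
      case 2
      then obtain x y where xy: "nb c = {x, y}" "x \<noteq> y"
        by (auto simp: card_2_iff)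
      have two: "local_shape k v" if xy: "nb c = {x, y}" "x \<noteq> y" and A: "A x c = 2" "A y c = 1" for x y
      proof -
        have "2 * g x + g y = 2 * g c"
          using sum xy A by simp
        then obtain t where "t > 0" "g c = 3 * t \<and> g x = 2 * t \<and> g y = 2 * t \<or>
            g c = 4 * t \<and> g x = 3 * t \<and> g y = 2 * t"
          using two_arms [of "g x" "g y" "g c"] c(2) nb xy by auto
        then show ?thesis
          using shape_F [OF c(1) xy] shape_F_dual [OF c(1) xy(1)] A nb(3) [of x] xy(1) v by auto
      qed
      have "A x c + A y c = 3" "1 \<le> A x c" "1 \<le> A y c"
        using W xy nb(5) by auto
      then have "A x c = 2 \<and> A y c = 1 \<or> A y c = 2 \<and> A x c = 1" by linarith
      then show ?thesis
        using two [of x y] two [of y x] xy by (auto simp: insert_commute)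
    next
      case 3
      then obtain x y z where xyz: "nb c = {x, y, z}" "x \<noteq> y" "x \<noteq> z" "y \<noteq> z"
        by (auto simp: card_3_iff)
      have "A x c + A y c + A z c = 3"
        using W xyz by simp
      then have A1: "A x c = 1" "A y c = 1" "A z c = 1"
        using nb(5) [of x] nb(5) [of y] nb(5) [of z] xyz(1) by auto
      have three: "local_shape k v"
        if xyz: "nb c = {x, y, z}" "x \<noteq> y" "x \<noteq> z" "y \<noteq> z"
          and A: "A x c = 1" "A y c = 1" "A z c = 1"
          and le: "g x \<le> g y" "g y \<le> g z" for x y z
      proof -
        have nbs: "x \<in> nb c" "y \<in> nb c" "z \<in> nb c"
          using xyz by auto
        have "g x + g y + g z = 2 * g c"
          using sum xyz A by simp
        then obtain t where t: "t > 0" "g c = 3 * t \<and> g x = 2 * t \<and> g y = 2 * t \<and> g z = 2 * t \<or>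
            g c = 4 * t \<and> g x = 2 * t \<and> g y = 3 * t \<and> g z = 3 * t \<or>
            g c = 6 * t \<and> g x = 3 * t \<and> g y = 4 * t \<and> g z = 5 * t"
          using three_arms [of "g x" "g y" "g z" "g c"] le c(2) [OF nbs(3)] nb(4) nbs by auto
        note A' = nb(3) [OF nbs(1)] nb(3) [OF nbs(2)] nb(3) [OF nbs(3)]
        from t(2) show ?thesis
        proof (elim disjE conjE)
          assume "g c = 3 * t" "g x = 2 * t" "g y = 2 * t" "g z = 2 * t"
          then show ?thesis
            using c(1) xyz(1) t(1) v by (intro shape_E6)
        next
          assume "g c = 4 * t" "g x = 2 * t" "g y = 3 * t" "g z = 3 * t"
          then show ?thesis
            using c(1) xyz(1,4) A A' t(1) v by (intro shape_E7)
        next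
          assume "g c = 6 * t" "g x = 3 * t" "g y = 4 * t" "g z = 5 * t"
          then show ?thesis
            using c(1) xyz(1) A A' t(1) v by (intro shape_E8)
        qed
      qed
      consider "g x \<le> g y" "g y \<le> g z" | "g x \<le> g z" "g z \<le> g y" | "g y \<le> g x" "g x \<le> g z"
        | "g y \<le> g z" "g z \<le> g x" | "g z \<le> g x" "g x \<le> g y" | "g z \<le> g y" "g y \<le> g x"
        by linarith
      then show ?thesis
      proof cases
        case 1
        then show ?thesis
          by (intro three [of x y z]) (use xyz A1 in \<open>simp_all add: insert_commute\<close>)
      next
        case 2
        then show ?thesis
          by (intro three [of x z y]) (use xyz A1 in \<open>simp_all add: insert_commute\<close>)
      next
        case 3
        then show ?thesis
          by (intro three [of y x z]) (use xyz A1 in \<open>simp_all add: insert_commute\<close>)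
      next
        case 4
        then show ?thesis
          by (intro three [of y z x]) (use xyz A1 in \<open>simp_all add: insert_commute\<close>)
      next
        case 5
        then show ?thesis
          by (intro three [of z x y]) (use xyz A1 in \<open>simp_all add: insert_commute\<close>)
      next
        case 6
        then show ?thesis
          by (intro three [of z y x]) (use xyz A1 in \<open>simp_all add: insert_commute\<close>)
      qed
    qed
  qed
qed

theorem local_shape:
  assumes "v \<in> V" "k dvd g v" "1 \<le> k"
  shows "local_shape k v"
proof (cases "k = 1")
  case True
  then show ?thesis
    by (intro local_shape_1) (simp add: I_nb_def)
next
  case False
  define M where "M = Max (g ` V)"
  have "M \<in> g ` V"
    unfolding M_def using finite_V assms(1) by (intro Max_in) auto
  then obtain c where c: "c \<in> V" "g c = M" by auto
  have max: "g u \<le> g c" if "u \<in> V" for u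
    using that finite_V by (simp add: c M_def)
  show ?thesis
  proof (cases "\<exists>u\<in>nb c. g u = g c")
    case True
    then show ?thesis
      using local_shape_plateau [OF c(1) max] assms \<open>k \<noteq> 1\<close> by auto
  next
    case f: False
    have "g u < g c" if "u \<in> nb c" for u
      using f that max [OF nb_V [OF that]] by (metis le_neq_implies_less)
    then show ?thesis
      using local_shape_peak [OF c(1)] assms \<open>k \<noteq> 1\<close> by auto
  qed
qed

end

section \<open>Types of nodes in a diagram\<close>

lemma exactly_one_Nil [simp]: "\<not> exactly_one []"
  by (auto simp: exactly_one_def)

text \<open>Together with the empty list this lets the simplifier evaluate
  \<open>exactly_one\<close> entry by entry.\<close>

lemma exactly_one_Cons [simp]:
  "exactly_one (P # Ps) \<longleftrightarrow> (if P then \<forall>Q\<in>set Ps. \<not> Q else exactly_one Ps)"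
proof (cases P)
  case True
  have "(\<exists>!i. i < length (P # Ps) \<and> (P # Ps) ! i) \<longleftrightarrow>
      (\<forall>i. i < length (P # Ps) \<and> (P # Ps) ! i \<longrightarrow> i = 0)"
    using True by auto
  also have "\<dots> \<longleftrightarrow> (\<forall>i<length Ps. \<not> Ps ! i)"
    using True by (auto simp: nth_Cons split: nat.splits)
  finally show ?thesis
    using True by (simp add: exactly_one_def all_set_conv_all_nth)
next
  case False
  have "(i < length (P # Ps) \<and> (P # Ps) ! i) \<longleftrightarrow> (\<exists>j. i = Suc j \<and> j < length Ps \<and> Ps ! j)" for i
    using False by (cases i) auto
  then have "(\<exists>!i. i < length (P # Ps) \<and> (P # Ps) ! i) \<longleftrightarrow> (\<exists>!j. j < length Ps \<and> Ps ! j)"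
    by auto
  then show ?thesis
    using False by (simp add: exactly_one_def)
qed

lemma nodes_subdiagram [simp]: "nodes (subdiagram D S) = nodes D \<inter> S"
  by (simp add: subdiagram_def)

lemma component_subset: "C \<in> diagram_components D \<Longrightarrow> C \<subseteq> nodes D"
  by (auto simp: diagram_components_def)

lemma component_eq:
  assumes sym: "\<And>u w. joined D u w \<Longrightarrow> joined D w u"
    and "C \<in> diagram_components D" "u \<in> C"
  shows "C = {w \<in> nodes D. (joined D)\<^sup>*\<^sup>* u w}"
proof -
  obtain x where C: "C = {w \<in> nodes D. (joined D)\<^sup>*\<^sup>* x w}"
    using assms(2) by (auto simp: diagram_components_def)
  have xu: "(joined D)\<^sup>*\<^sup>* x u"
    using assms(3) C by simp
  have "symp (joined D)\<^sup>*\<^sup>*"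
    using sym by (intro symp_rtranclp sympI)
  then have "(joined D)\<^sup>*\<^sup>* u x"
    using xu by (rule sympD)
  with xu show ?thesis
    unfolding C by (auto intro: rtranclp_trans)
qed

section \<open>Mutual exclusion of the types\<close>

lemma adjacent_component:
  assumes "C \<in> adjacent_components D D' v"
  obtains u where "u \<in> C" "u \<in> adjacent_nodes D D' v"
  using assms component_subset by (auto simp: adjacent_components_def adjacent_nodes_def)

text \<open>Sizes of components are enough to tell the types A1, A2 and A3 apart.\<close>

lemma component_type_A_card:
  assumes "component_type_A m D C" "C \<in> adjacent_components D0 D v"
  shows "card C = m"
proof -
  have "C \<subseteq> nodes D"
    using assms(2) component_subset by (auto simp: adjacent_components_def)
  then show ?thesis
    using assms(1) bij_betw_same_card
    by (fastforce simp: component_type_A_def type_A_def inf_absorb2)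
qed

text \<open>Separates the types with two components from Types 1 and 2(ii), which have no or exactly
  one adjacent node.\<close>

lemma two_components_adjacent_nodes:
  assumes sym: "\<And>u w. joined D' u w \<Longrightarrow> joined D' w u"
    and "adjacent_components D D' v = {C1, C2}" "C1 \<noteq> C2"
  shows "adjacent_nodes D D' v \<noteq> {}" "adjacent_nodes D D' v \<noteq> {x}"
proof -
  obtain a where a: "a \<in> C1" "a \<in> adjacent_nodes D D' v"
    using assms(2) adjacent_component by (metis insertI1)
  obtain b where b: "b \<in> C2" "b \<in> adjacent_nodes D D' v"
    using assms(2) adjacent_component by (metis insertI1 insert_commute)
  have "C1 \<in> diagram_components D'" "C2 \<in> diagram_components D'"
    using assms(2) by (auto simp: adjacent_components_def)
  then have "C1 = {w \<in> nodes D'. (joined D')\<^sup>*\<^sup>* a w}" "C2 = {w \<in> nodes D'. (joined D')\<^sup>*\<^sup>* b w}"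
    using component_eq [OF sym, of C1 a] component_eq [OF sym, of C2 b] a(1) b(1) by simp_all
  then have "a \<noteq> b"
    using assms(3) by blast
  then show "adjacent_nodes D D' v \<noteq> {}" "adjacent_nodes D D' v \<noteq> {x}"
    using a b by auto
qed

text \<open>The components and nodes in the types are existentially bound. Types 2(i), 3 and 4 are
  therefore compared through quantities free of choices: the set of sizes of the adjacent components
  and, against Type 4(i), a statement on all their nodes.\<close>

lemma type_2i_imp:
  assumes "type_2i D D' l v"
  shows "card ` adjacent_components D D' v = {1}"
    "\<forall>C\<in>adjacent_components D D' v. \<forall>x\<in>C. l v \<le> l x"
proof -
  obtain C1 C2 v1 v2 where C: "adjacent_components D D' v = {C1, C2}"
      "component_type_A 1 D' C1" "component_type_A 1 D' C2" "v1 \<in> C1" "v2 \<in> C2"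
      "l v \<le> min (l v1) (l v2)"
    using assms by (auto simp: type_2i_def)
  then have card: "card C1 = 1" "card C2 = 1"
    using component_type_A_card [of 1 D' C1 D v] component_type_A_card [of 1 D' C2 D v] by auto
  then show "card ` adjacent_components D D' v = {1}"
    using C by simp
  have "C1 = {v1}" "C2 = {v2}"
    using card C by (auto simp: card_1_singleton_iff)
  then show "\<forall>C\<in>adjacent_components D D' v. \<forall>x\<in>C. l v \<le> l x"
    using C by simp
qed

lemma type_3_imp:
  assumes "type_3 D D' v"
  shows "card ` adjacent_components D D' v = {2}"
proof -
  obtain C1 C2 where C: "adjacent_components D D' v = {C1, C2}"
      "component_type_A 2 D' C1" "component_type_A 2 D' C2"
    using assms by (auto simp: type_3_def)
  then show ?thesis
    using component_type_A_card [of 2 D' C1 D v] component_type_A_card [of 2 D' C2 D v] by auto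
qed

lemma type_4_imp:
  assumes "type_4 D D' l v"
  shows "3 \<in> card ` adjacent_components D D' v \<or>
    card ` adjacent_components D D' v = {1} \<and>
    \<not> (\<forall>C\<in>adjacent_components D D' v. \<forall>x\<in>C. l v \<le> l x)"
proof -
  obtain C1 C2 where C: "adjacent_components D D' v = {C1, C2}"
    and "component_type_A 1 D' C1 \<and> component_type_A 1 D' C2 \<and>
             (\<exists>v1\<in>C1. \<exists>v2\<in>C2. l v > min (l v1) (l v2)) \<or>
           component_type_A 3 D' C1 \<or> component_type_A 3 D' C2"
    using assms by (auto simp: type_4_def split: if_splits)
  then consider "card C1 = 1" "card C2 = 1" "\<exists>v1\<in>C1. \<exists>v2\<in>C2. l v > min (l v1) (l v2)"
    | "card C1 = 3" | "card C2 = 3"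
    using component_type_A_card [of _ D' C1 D v] component_type_A_card [of _ D' C2 D v] by blast
  then show ?thesis
    by cases (auto simp: C min_less_iff_disj not_le)
qed

lemma types_exactly_one:
  assumes sym: "\<And>u w. joined D' u w \<Longrightarrow> joined D' w u"
    and some: "type_infinity D D' v \<or> type_1 D D' v \<or> type_2i D D' l v \<or> type_2ii D D' l v \<or>
      type_3 D D' v \<or> type_4 D D' l v"
  shows "exactly_one [type_infinity D D' v, type_1 D D' v, type_2i D D' l v, type_2ii D D' l v,
    type_3 D D' v, type_4 D D' l v]"
proof -
  let ?N = "adjacent_nodes D D' v" and ?C = "card ` adjacent_components D D' v"
  have inf: "\<not> type_infinity D D' v"
    if "type_1 D D' v \<or> type_2i D D' l v \<or> type_2ii D D' l v \<or> type_3 D D' v \<or> type_4 D D' l v"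
    using that unfolding type_1_def type_2i_def type_2ii_def type_3_def type_4_def by blast
  have N1: "?N = {}" if "type_1 D D' v"
    using that by (auto simp: type_1_def adjacent_nodes_def)
  have N2: "\<exists>x. ?N = {x}" if "type_2ii D D' l v"
    using that by (auto simp: type_2ii_def)
  have N3: "?N \<noteq> {} \<and> (\<forall>x. ?N \<noteq> {x})" if "type_2i D D' l v \<or> type_3 D D' v \<or> type_4 D D' l v"
    using that two_components_adjacent_nodes [OF sym, of D v]
    unfolding type_2i_def type_3_def type_4_def by meson
  have n: "\<not> (type_1 D D' v \<and> type_2ii D D' l v)"
    "\<not> ((type_1 D D' v \<or> type_2ii D D' l v) \<and> (type_2i D D' l v \<or> type_3 D D' v \<or> type_4 D D' l v))"
    using N1 N2 N3 by (metis insert_not_empty)+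
  have "\<not> (type_2i D D' l v \<and> type_3 D D' v)"
    using type_2i_imp(1) [of D D' l v] type_3_imp [of D D' v] by auto
  moreover have "\<not> (type_2i D D' l v \<and> type_4 D D' l v)"
    using type_2i_imp [of D D' l v] type_4_imp [of D D' l v] by auto
  moreover have "\<not> (type_3 D D' v \<and> type_4 D D' l v)"
    using type_3_imp [of D D' v] type_4_imp [of D D' l v] by auto
  ultimately show ?thesis
    using some inf n by auto
qed

section \<open>From local shapes to types\<close>

lemma type_A_list:
  assumes "distinct xs" "nodes D = set xs"
    and "\<And>i j. i < length xs \<Longrightarrow> j < length xs \<Longrightarrow>
      bonds D (xs ! i) (xs ! j) = (if i = Suc j \<or> j = Suc i then {#1#} else {#})"
  shows "type_A (length xs) D"
  using assms bij_betw_nth [OF assms(1) refl refl]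
  unfolding type_A_def by (intro exI [of _ "(!) xs"]) auto

text \<open>The diagram is tied to the weights only by the presence of bonds and by the bonds with
  both weights 1. Recognising components of type A requires no other multiplicities.\<close>

locale graph_diagram = harmonic_graph V A g
  for V :: "'v set" and A :: "'v \<Rightarrow> 'v \<Rightarrow> nat" and g :: "'v \<Rightarrow> nat" +
  fixes D D' :: "'v diagram" and k :: nat
  assumes nodes_D: "nodes D = V"
    and bonds_D: "\<And>u w. u \<in> V \<Longrightarrow> w \<in> V \<Longrightarrow> bonds D u w = {#} \<longleftrightarrow> A u w = 0"
    and single_bond: "\<And>u w. u \<in> V \<Longrightarrow> w \<in> V \<Longrightarrow> A u w = 1 \<Longrightarrow> A w u = 1 \<Longrightarrow> bonds D u w = {#1#}"
    and D': "D' = subdiagram D {u \<in> V. \<not> k dvd g u}"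
begin

lemma nodes_D': "nodes D' = {u \<in> V. \<not> k dvd g u}"
  by (auto simp: D' nodes_D)

lemma bonds_D': "u \<in> nodes D' \<Longrightarrow> w \<in> nodes D' \<Longrightarrow> bonds D' u w = bonds D u w"
  by (auto simp: D' subdiagram_def)

lemma joined_D: "joined D u w \<longleftrightarrow> u \<in> V \<and> w \<in> nb u"
  using bonds_D [of u w] bonds_D [of w u] A_sym [of u w] by (auto simp: joined_def nodes_D nb_def)

lemma joined_D': "joined D' u w \<longleftrightarrow> u \<in> nodes D' \<and> w \<in> I_nb k u"
  using bonds_D [of u w] bonds_D [of w u] A_sym [of u w] by (auto simp: joined_def bonds_D' nodes_D' nb_def I_nb_def)

lemma joined_D'_sym: "joined D' u w \<Longrightarrow> joined D' w u"
  using bonds_D [of u w] bonds_D [of w u] A_sym [of u w] by (auto simp: joined_def bonds_D' nodes_D')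

lemma I_nb_nodes: "I_nb k u \<subseteq> nodes D'"
  by (auto simp: I_nb_def nb_def nodes_D')

lemma adjacent_nodes: "v \<in> V \<Longrightarrow> adjacent_nodes D D' v = I_nb k v"
  using joined_D by (auto simp: adjacent_nodes_def I_nb_def nodes_D' nb_V)

lemma bonds_I_nb:
  "u \<in> nodes D' \<Longrightarrow> w \<in> nodes D' \<Longrightarrow> bonds D' u w = {#} \<longleftrightarrow> w \<notin> I_nb k u"
  using joined_D' by (auto simp: joined_def)

lemma bonds_single:
  "u \<in> nodes D' \<Longrightarrow> w \<in> nodes D' \<Longrightarrow> A u w = 1 \<Longrightarrow> A w u = 1 \<Longrightarrow> bonds D' u w = {#1#}"
  using single_bond by (simp add: bonds_D' nodes_D')

lemma component_eqI:
  assumes "C \<subseteq> nodes D'" "u \<in> C" "\<And>x. x \<in> C \<Longrightarrow> I_nb k x \<subseteq> C" "\<And>x. x \<in> C \<Longrightarrow> (joined D')\<^sup>*\<^sup>* u x"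
  shows "{w \<in> nodes D'. (joined D')\<^sup>*\<^sup>* u w} = C"
proof -
  have "w \<in> C" if "(joined D')\<^sup>*\<^sup>* u w" for w
    using that by induction (use assms(2,3) joined_D' in auto)
  then show ?thesis
    using assms(1,4) by blast
qed

lemma component_type_A_list:
  assumes "distinct xs" "set xs \<subseteq> nodes D'"
    and "\<And>i j. i < length xs \<Longrightarrow> j < length xs \<Longrightarrow>
      bonds D' (xs ! i) (xs ! j) = (if i = Suc j \<or> j = Suc i then {#1#} else {#})"
  shows "component_type_A (length xs) D' (set xs)"
  unfolding component_type_A_def
  using assms by (intro type_A_list) (auto simp: subdiagram_def)

lemma chain1_component:
  assumes "chain1 k C" "a \<in> C" "a \<in> nodes D'"
  shows "C = {w \<in> nodes D'. (joined D')\<^sup>*\<^sup>* a w}" "component_type_A 1 D' C"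
proof -
  have a: "C = {a}" "I_nb k a = {}"
    using assms by (auto simp: chain1_def)
  then show "C = {w \<in> nodes D'. (joined D')\<^sup>*\<^sup>* a w}"
    using assms by (intro component_eqI [symmetric]) auto
  show "component_type_A 1 D' C"
    using component_type_A_list [of "[a]"] bonds_I_nb [of a a] assms a by simp
qed

lemma chain2_component:
  assumes "chain2 k C" "a \<in> C"
  shows "C = {w \<in> nodes D'. (joined D')\<^sup>*\<^sup>* a w}" "component_type_A 2 D' C"
proof -
  obtain x y where C: "C = {x, y}" "I_nb k x = {y}" "I_nb k y = {x}" "x \<noteq> y" "A x y = 1" "A y x = 1"
    using assms(1) by (auto simp: chain2_def)
  have nodes: "x \<in> nodes D'" "y \<in> nodes D'"
    using C I_nb_nodes by blast+
  then have "joined D' x y" "joined D' y x"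
    using C by (auto simp: joined_D')
  then show "C = {w \<in> nodes D'. (joined D')\<^sup>*\<^sup>* a w}"
    using C nodes assms(2) by (intro component_eqI [symmetric]) auto
  have "bonds D' x y = {#1#}" "bonds D' y x = {#1#}" "bonds D' x x = {#}" "bonds D' y y = {#}"
    using bonds_single bonds_I_nb nodes C by auto
  note b = this
  have "component_type_A (length [x, y]) D' (set [x, y])"
  proof (rule component_type_A_list)
    fix i j assume "i < length [x, y]" "j < length [x, y]"
    then have "i \<in> {0, 1}" "j \<in> {0, 1}" by auto
    then show "bonds D' ([x, y] ! i) ([x, y] ! j) = (if i = Suc j \<or> j = Suc i then {#1#} else {#})"
      using b by auto
  qed (use nodes C in auto)
  then show "component_type_A 2 D' C"
    using C by (simp add: numeral_2_eq_2)
qed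

lemma chain3_component:
  assumes "chain3 k C" "a \<in> C"
  shows "C = {w \<in> nodes D'. (joined D')\<^sup>*\<^sup>* a w}" "component_type_A 3 D' C"
proof -
  obtain x y z where C: "C = {x, y, z}" "I_nb k x = {y}" "I_nb k y = {x, z}" "I_nb k z = {y}"
      "x \<noteq> y" "y \<noteq> z" "x \<noteq> z" "A x y = 1" "A y x = 1" "A y z = 1" "A z y = 1"
    using assms(1) by (auto simp: chain3_def)
  have nodes: "x \<in> nodes D'" "y \<in> nodes D'" "z \<in> nodes D'"
    using C I_nb_nodes by blast+
  then have j: "joined D' x y" "joined D' y x" "joined D' y z" "joined D' z y"
    using C by (auto simp: joined_D')
  then have "(joined D')\<^sup>*\<^sup>* x z" "(joined D')\<^sup>*\<^sup>* z x"
    by (meson converse_rtranclp_into_rtranclp r_into_rtranclp)+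
  then show "C = {w \<in> nodes D'. (joined D')\<^sup>*\<^sup>* a w}"
    using C nodes assms(2) j by (intro component_eqI [symmetric]) auto
  have b: "bonds D' x y = {#1#}" "bonds D' y x = {#1#}" "bonds D' y z = {#1#}" "bonds D' z y = {#1#}"
    using bonds_single nodes C by auto
  have b0: "bonds D' x x = {#}" "bonds D' y y = {#}" "bonds D' z z = {#}" "bonds D' x z = {#}"
    "bonds D' z x = {#}"
    using bonds_I_nb nodes C by auto
  have "component_type_A (length [x, y, z]) D' (set [x, y, z])"
  proof (rule component_type_A_list)
    fix i j assume "i < length [x, y, z]" "j < length [x, y, z]"
    then have "i \<in> {0, 1, 2}" "j \<in> {0, 1, 2}" by auto
    then show "bonds D' ([x, y, z] ! i) ([x, y, z] ! j) = (if i = Suc j \<or> j = Suc i then {#1#} else {#})"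
      using b b0 by auto
  qed (use nodes C in auto)
  then show "component_type_A 3 D' C"
    using C by (simp add: numeral_3_eq_3)
qed

lemma two_components:
  assumes "v \<in> V" "I_nb k v = {a, b}" "a \<in> C1" "b \<in> C2"
    and C1: "C1 = {w \<in> nodes D'. (joined D')\<^sup>*\<^sup>* a w}" and C2: "C2 = {w \<in> nodes D'. (joined D')\<^sup>*\<^sup>* b w}"
  shows "adjacent_components D D' v = {C1, C2}"
proof -
  have ab: "joined D v a" "joined D v b" "a \<in> nodes D'" "b \<in> nodes D'"
    using assms(1,2) I_nb_nodes [of v] by (auto simp: joined_D I_nb_def)
  have "C \<in> {C1, C2}" if C: "C \<in> adjacent_components D D' v" for C
  proof -
    obtain u where u: "u \<in> C" "u \<in> I_nb k v"
      using adjacent_component [OF C] adjacent_nodes [OF assms(1)] by metis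
    have "C = {w \<in> nodes D'. (joined D')\<^sup>*\<^sup>* u w}"
      using C u(1) component_eq [OF joined_D'_sym, of C u] by (simp add: adjacent_components_def)
    then show ?thesis
      using u assms(2) C1 C2 by auto
  qed
  moreover have "C1 \<in> diagram_components D'" "C2 \<in> diagram_components D'"
    using ab C1 C2 by (auto simp: diagram_components_def)
  then have "C1 \<in> adjacent_components D D' v" "C2 \<in> adjacent_components D D' v"
    using ab assms(3,4) by (auto simp: adjacent_components_def)
  ultimately show ?thesis by blast
qed

lemma some_type:
  assumes v: "v \<in> V" "k dvd g v" and k: "1 \<le> k"
    and l: "\<And>a. a \<in> nb v \<Longrightarrow> A v a < A a v \<Longrightarrow> l v < l a"
  shows "type_infinity D D' v \<or> type_1 D D' v \<or> type_2i D D' l v \<or> type_2ii D D' l v \<or>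
    type_3 D D' v \<or> type_4 D D' l v"
proof (cases "type_infinity D D' v")
  case not_inf: False
  have "\<not> (\<forall>u\<in>V. k dvd g u \<longrightarrow> u = v)"
    using not_inf v by (auto simp: type_infinity_def nodes_D nodes_D')
  then consider "I_nb k v = {}" | a where "I_nb k v = {a}" "A v a < A a v"
    | C1 C2 where "two_chains k v C1 C2" "chain1 k C1 \<and> chain1 k C2 \<or> chain2 k C1 \<and> chain2 k C2 \<or>
        chain3 k C1 \<and> chain3 k C2 \<or> chain3 k C1 \<and> chain1 k C2"
    using local_shape [OF v k] unfolding local_shape_def by blast
  then show ?thesis
  proof cases
    case 1
    then show ?thesis
      using not_inf adjacent_nodes [OF v(1)] by (auto simp: type_1_def adjacent_nodes_def)
  next
    case 2
    then have "type_2ii D D' l v"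
      using not_inf adjacent_nodes [OF v(1)] l [of a] by (auto simp: type_2ii_def I_nb_def)
    then show ?thesis by simp
  next
    case 3
    then obtain a b where ab: "I_nb k v = {a, b}" "a \<in> C1" "b \<in> C2" "a \<notin> C2"
      by (auto simp: two_chains_def)
    have nodes: "a \<in> nodes D'" "b \<in> nodes D'"
      using ab I_nb_nodes [of v] by auto
    have comps: "C1 = {w \<in> nodes D'. (joined D')\<^sup>*\<^sup>* a w}" "C2 = {w \<in> nodes D'. (joined D')\<^sup>*\<^sup>* b w}"
      using 3(2) chain1_component(1) chain2_component(1) chain3_component(1) ab nodes by metis+
    have C: "C1 \<noteq> C2" "adjacent_components D D' v = {C1, C2}"
      using ab two_components [OF v(1) ab(1-3) comps] by auto
    \<comment> \<open>The sizes refute the alternatives that \<open>exactly_one\<close> in Type 4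
      has to exclude.\<close>
    have card: "card C1 = m" if "component_type_A m D' C1" for m
      using component_type_A_card [OF that] C by blast
    have card': "card C2 = m" if "component_type_A m D' C2" for m
      using component_type_A_card [OF that] C by blast
    show ?thesis
      using 3(2)
    proof (elim disjE conjE)
      assume c: "chain1 k C1" "chain1 k C2"
      then have single: "C1 = {a}" "C2 = {b}"
        using ab by (auto simp: chain1_def)
      have t: "component_type_A 1 D' C1" "component_type_A 1 D' C2"
        using c chain1_component(2) ab nodes by blast+
      have f: "\<not> component_type_A 3 D' C1" "\<not> component_type_A 3 D' C2"
        using card [of 1] card' [of 1] card [of 3] card' [of 3] t by auto
      show ?thesis
      proof (cases "l v \<le> min (l a) (l b)")
        case True
        then have "type_2i D D' l v"
          unfolding type_2i_def using not_inf C t ab by blast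
        then show ?thesis by simp
      next
        case False
        then have "exactly_one
          [component_type_A 1 D' C1 \<and> component_type_A 1 D' C2 \<and>
             (\<exists>v1\<in>C1. \<exists>v2\<in>C2. l v > min (l v1) (l v2)),
           component_type_A 3 D' C1 \<and> component_type_A 3 D' C2,
           (component_type_A 3 D' C1 \<and> component_type_A 1 D' C2) \<or>
             (component_type_A 1 D' C1 \<and> component_type_A 3 D' C2)]"
          using t f single by auto
        then have "type_4 D D' l v"
          unfolding type_4_def using not_inf C by blast
        then show ?thesis by simp
      qed
    next
      assume "chain2 k C1" "chain2 k C2"
      then have "type_3 D D' v"
        unfolding type_3_def using chain2_component(2) ab not_inf C by blast
      then show ?thesis by simp
    next
      assume "chain3 k C1" "chain3 k C2"
      then have t: "component_type_A 3 D' C1" "component_type_A 3 D' C2"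
        using chain3_component(2) ab by blast+
      then have f: "\<not> component_type_A 1 D' C1" "\<not> component_type_A 1 D' C2"
        using card [of 1] card' [of 1] card [of 3] card' [of 3] by auto
      have "exactly_one
          [component_type_A 1 D' C1 \<and> component_type_A 1 D' C2 \<and>
             (\<exists>v1\<in>C1. \<exists>v2\<in>C2. l v > min (l v1) (l v2)),
           component_type_A 3 D' C1 \<and> component_type_A 3 D' C2,
           (component_type_A 3 D' C1 \<and> component_type_A 1 D' C2) \<or>
             (component_type_A 1 D' C1 \<and> component_type_A 3 D' C2)]"
        using t f by auto
      then have "type_4 D D' l v"
        unfolding type_4_def using not_inf C by blast
      then show ?thesis by simp
    next
      assume "chain3 k C1" "chain1 k C2"
      then have t: "component_type_A 3 D' C1" "component_type_A 1 D' C2"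
        using chain3_component(2) chain1_component(2) ab nodes by blast+
      then have f: "\<not> component_type_A 1 D' C1" "\<not> component_type_A 3 D' C2"
        using card [of 1] card' [of 1] card [of 3] card' [of 3] by auto
      have "exactly_one
          [component_type_A 1 D' C1 \<and> component_type_A 1 D' C2 \<and>
             (\<exists>v1\<in>C1. \<exists>v2\<in>C2. l v > min (l v1) (l v2)),
           component_type_A 3 D' C1 \<and> component_type_A 3 D' C2,
           (component_type_A 3 D' C1 \<and> component_type_A 1 D' C2) \<or>
             (component_type_A 1 D' C1 \<and> component_type_A 3 D' C2)]"
        using t f by auto
      then have "type_4 D D' l v"
        unfolding type_4_def using not_inf C by blast
      then show ?thesis by simp
    qed
  qed
qed simp

end

section \<open>The diagram of a root system\<close>

text \<open>Since \<open>coroot\<close> is an involution, \<open>g (coroot u)\<close> is the coroot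
  integer attached to the node u.\<close>

lemma coroot_coroot [simp]: "coroot (coroot a) = a"
  by (cases "a = 0") (simp_all add: coroot_def)

lemma inj_coroot: "inj_on coroot S"
  by (metis coroot_coroot inj_onI)

lemma inner_coroot_self: "a \<noteq> 0 \<Longrightarrow> a \<bullet> coroot a = 2"
  by (simp add: coroot_def)

lemma inner_coroot_le_0_iff:
  assumes "a \<noteq> 0"
  shows "b \<bullet> coroot a \<le> 0 \<longleftrightarrow> a \<bullet> b \<le> 0"
proof -
  have "0 < 2 / (a \<bullet> a)"
    using assms by simp
  then show ?thesis
    unfolding coroot_def inner_scaleR_right by (simp only: mult_le_0_iff inner_commute) linarith
qed

lemma independent_coeff_eq:
  fixes \<Delta> :: "'a::euclidean_space set"
  assumes "independent \<Delta>" "(\<Sum>a\<in>\<Delta>. c a *\<^sub>R a) = (\<Sum>a\<in>\<Delta>. d a *\<^sub>R a)" "a \<in> \<Delta>"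
  shows "c a = d a"
proof -
  have "(\<Sum>a\<in>\<Delta>. (c a - d a) *\<^sub>R a) = 0"
    using assms(2) by (simp add: scaleR_left_diff_distrib sum_subtractf)
  then have "c a - d a = 0"
    using independentD [OF assms(1) independent_imp_finite [OF assms(1)] subset_refl _ assms(3),
        of "\<lambda>a. c a - d a"] by simp
  then show ?thesis by simp
qed

lemma independent_no_positive_relation:
  fixes \<Delta> :: "'a::euclidean_space set"
  assumes "independent \<Delta>" "B \<subseteq> \<Delta>" "B \<noteq> {}" "\<And>a. a \<in> B \<Longrightarrow> 0 < (c a :: real)"
  shows "(\<Sum>a\<in>B. c a *\<^sub>R a) \<noteq> 0"
proof
  assume sum: "(\<Sum>a\<in>B. c a *\<^sub>R a) = 0"
  obtain b where b: "b \<in> B"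
    using assms(3) by blast
  have "c b = 0"
    using independentD [OF assms(1) _ assms(2) sum b]
      finite_subset [OF assms(2) independent_imp_finite [OF assms(1)]] by simp
  then show False
    using assms(4) [OF b] by simp
qed

text \<open>For joined nodes other than the two of \<open>A\<^sub>1\<close>, the smaller of \<open>cartan u w\<close> and \<open>cartan w u\<close> is 1
  and the larger is the multiplicity of the bond; \<open>cartan u w\<close> is the larger one iff \<open>u\<close> is longer.\<close>

definition cartan :: "'a::euclidean_space \<Rightarrow> 'a \<Rightarrow> nat" where
  "cartan u w = (if u = w then 0 else nat \<lfloor>- (u \<bullet> coroot w)\<rfloor>)"

section \<open>Signs of the inner products in the extended set of simple roots\<close>

locale extended_simple_roots =
  fixes \<Psi> \<Delta> E :: "'a::euclidean_space set" and \<alpha> :: 'a and g :: "'a \<Rightarrow> nat"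
  assumes root_system: "root_system \<Psi>"
    and simple: "simple_roots \<Psi> \<Delta>"
    and highest: "highest_root \<Psi> \<Delta> (- \<alpha>)"
    and E: "E = insert \<alpha> \<Delta>"
    and g: "coroot_integers E g"
begin

lemma finite_roots: "finite \<Psi>"
  and zero_not_root: "0 \<notin> \<Psi>"
  and reflection: "a \<in> \<Psi> \<Longrightarrow> b \<in> \<Psi> \<Longrightarrow> b - (b \<bullet> coroot a) *\<^sub>R a \<in> \<Psi>"
  and integral: "a \<in> \<Psi> \<Longrightarrow> b \<in> \<Psi> \<Longrightarrow> b \<bullet> coroot a \<in> \<int>"
  using root_system by (auto simp: root_system_def)

lemma simple_subset: "\<Delta> \<subseteq> \<Psi>" and independent: "independent \<Delta>"
  using simple by (auto simp: simple_roots_def)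

lemma finite_simple: "finite \<Delta>"
  using simple_subset finite_roots by (rule finite_subset)

lemma uminus_root: "a \<in> \<Psi> \<Longrightarrow> - a \<in> \<Psi>"
  using reflection [of a a] zero_not_root inner_coroot_self [of a]
  by (cases "a = 0") (simp_all add: scaleR_2)

lemma E_subset: "E \<subseteq> \<Psi>"
  using highest uminus_root [of "- \<alpha>"] simple_subset by (auto simp: E highest_root_def)

lemma finite_E: "finite E"
  using finite_simple by (simp add: E)

lemma E_nonzero: "a \<in> E \<Longrightarrow> a \<noteq> 0"
  using E_subset zero_not_root by auto

lemma single_coeff:
  assumes "a \<in> \<Delta>"
  shows "r *\<^sub>R a = (\<Sum>x\<in>\<Delta>. (if x = a then r else 0) *\<^sub>R x)"
  using assms finite_simple by (simp add: if_distrib [of "\<lambda>t. t *\<^sub>R _"] cong: if_cong)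

text \<open>The reflection of b in a is a root with coefficient 1 at b, so its coefficient at a,
  which is minus the Cartan integer, cannot be negative.\<close>

lemma simple_inner_coroot:
  assumes a: "a \<in> \<Delta>" and b: "b \<in> \<Delta>" and "a \<noteq> b"
  shows "b \<bullet> coroot a \<le> 0"
proof -
  let ?r = "b \<bullet> coroot a"
  let ?d = "\<lambda>x. (if x = b then 1 else 0) + (if x = a then - ?r else 0)"
  have "b - ?r *\<^sub>R a \<in> \<Psi>"
    using a b simple_subset reflection by auto
  then obtain c :: "'a \<Rightarrow> nat" where
    c: "b - ?r *\<^sub>R a = (\<Sum>x\<in>\<Delta>. real (c x) *\<^sub>R x) \<or> b - ?r *\<^sub>R a = - (\<Sum>x\<in>\<Delta>. real (c x) *\<^sub>R x)"
    using simple unfolding simple_roots_def by blast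
  have d: "b - ?r *\<^sub>R a = (\<Sum>x\<in>\<Delta>. ?d x *\<^sub>R x)"
    using single_coeff [OF b, of 1] single_coeff [OF a, of "- ?r"]
    by (simp add: scaleR_left_distrib sum.distrib)
  from c show ?thesis
  proof
    assume "b - ?r *\<^sub>R a = (\<Sum>x\<in>\<Delta>. real (c x) *\<^sub>R x)"
    then have "real (c a) = ?d a"
      using d by (intro independent_coeff_eq [OF independent _ a]) simp
    then show ?thesis
      using assms(3) by simp
  next
    assume "b - ?r *\<^sub>R a = - (\<Sum>x\<in>\<Delta>. real (c x) *\<^sub>R x)"
    then have "- real (c b) = ?d b"
      using d by (intro independent_coeff_eq [OF independent _ b]) (simp add: sum_negf)
    then show ?thesis
      using assms(3) by simp
  qed
qed

text \<open>Reflecting the highest root in a subtracts a multiple of a. By maximality this multiple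
  is a natural number.\<close>

lemma simple_inner_lowest:
  assumes a: "a \<in> \<Delta>"
  shows "\<alpha> \<bullet> coroot a \<le> 0"
proof -
  let ?r = "(- \<alpha>) \<bullet> coroot a"
  have "- \<alpha> - ?r *\<^sub>R a \<in> \<Psi>"
    using a simple_subset highest by (intro reflection) (auto simp: highest_root_def)
  then obtain c :: "'a \<Rightarrow> nat" where "- \<alpha> - (- \<alpha> - ?r *\<^sub>R a) = (\<Sum>x\<in>\<Delta>. real (c x) *\<^sub>R x)"
    using highest unfolding highest_root_def by blast
  then have "real (c a) = (if a = a then ?r else 0)"
    using single_coeff [OF a, of ?r] by (intro independent_coeff_eq [OF independent _ a]) simp
  then have "?r = real (c a)"
    by simp
  then show ?thesis
    by (simp add: inner_minus_left)
qed

lemma E_inner_coroot: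
  assumes "a \<in> E" "b \<in> E" "a \<noteq> b"
  shows "b \<bullet> coroot a \<le> 0"
proof -
  consider "a \<in> \<Delta>" "b \<in> \<Delta>" | "a \<in> \<Delta>" "b = \<alpha>" | "a = \<alpha>" "b \<in> \<Delta>"
    using assms by (auto simp: E)
  then show ?thesis
  proof cases
    case 3
    then have "\<alpha> \<bullet> coroot b \<le> 0"
      using simple_inner_lowest by simp
    then show ?thesis
      using 3 assms E_nonzero by (simp add: inner_coroot_le_0_iff inner_commute)
  qed (use assms simple_inner_coroot simple_inner_lowest in auto)
qed

section \<open>The weighted graph of the coroots\<close>

abbreviation V :: "'a set" where "V \<equiv> coroot ` E"

lemma V_nonzero: "u \<in> V \<Longrightarrow> u \<noteq> 0"
  using E_nonzero by (metis coroot_coroot coroot_def imageE scaleR_zero_right)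

lemma real_cartan:
  assumes "u \<in> V" "w \<in> V" "u \<noteq> w"
  shows "real (cartan u w) = - (u \<bullet> coroot w)"
proof -
  obtain a b where ab: "a \<in> E" "b \<in> E" "u = coroot a" "w = coroot b"
    using assms by auto
  \<comment> \<open>Passing to coroots transposes the Cartan matrix, so integrality and sign are
    inherited from the roots.\<close>
  have eq: "u \<bullet> coroot w = b \<bullet> coroot a"
    using ab by (simp add: inner_commute)
  have "u \<bullet> coroot w \<in> \<int>"
    unfolding eq using ab E_subset integral by blast
  moreover have "u \<bullet> coroot w \<le> 0"
    unfolding eq using ab assms by (intro E_inner_coroot) auto
  ultimately show ?thesis
    using assms(3) by (auto simp: cartan_def elim!: Ints_cases)
qed

lemma cartan_inner:
  assumes "u \<in> V" "w \<in> V" "u \<noteq> w"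
  shows "real (cartan u w) * (w \<bullet> w) = - 2 * (u \<bullet> w)"
  unfolding real_cartan [OF assms] using V_nonzero [OF assms(2)] by (simp add: coroot_def)

lemma cartan_eq_0_iff:
  assumes "u \<in> V" "w \<in> V"
  shows "cartan u w = 0 \<longleftrightarrow> u = w \<or> u \<bullet> w = 0"
proof (cases "u = w")
  case False
  then show ?thesis
    using cartan_inner [OF assms] V_nonzero [OF assms(2)] by auto
qed (simp add: cartan_def)

lemma relation: "(\<Sum>a\<in>E. real (g a) *\<^sub>R coroot a) = 0"
  and g_pos: "a \<in> E \<Longrightarrow> 0 < g a"
  and Gcd_g: "Gcd (g ` E) = 1"
  using g by (auto simp: coroot_integers_def)

lemma cartan_harmonic:
  assumes "w \<in> V"
  shows "(\<Sum>u\<in>V. cartan u w * g (coroot u)) = 2 * g (coroot w)"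
proof -
  obtain b where b: "b \<in> E" "w = coroot b"
    using assms by auto
  have "real (\<Sum>u\<in>V. cartan u w * g (coroot u)) = (\<Sum>a\<in>E. real (cartan (coroot a) w) * real (g a))"
    by (simp add: sum.reindex [OF inj_coroot])
  \<comment> \<open>The relation is paired with b. Its diagonal term is 2 g b whereas
    \<open>cartan\<close> is 0 there; the case distinction makes up for this.\<close>
  also have "\<dots> = (\<Sum>a\<in>E. (if a = b then 2 * real (g b) else 0) - b \<bullet> (real (g a) *\<^sub>R coroot a))"
  proof (rule sum.cong)
    fix a assume a: "a \<in> E"
    show "real (cartan (coroot a) w) * real (g a) =
        (if a = b then 2 * real (g b) else 0) - b \<bullet> (real (g a) *\<^sub>R coroot a)"
    proof (cases "a = b")
      case True
      then show ?thesis
        using b E_nonzero inner_coroot_self [of b] by (simp add: cartan_def)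
    next
      case False
      then have "coroot a \<noteq> w"
        using b(2) by (metis coroot_coroot)
      then show ?thesis
        using False a b real_cartan [of "coroot a" w] by (simp add: inner_commute)
    qed
  qed simp
  also have "\<dots> = 2 * real (g b) - b \<bullet> (\<Sum>a\<in>E. real (g a) *\<^sub>R coroot a)"
    using b(1) finite_E by (simp add: sum_subtractf inner_sum_right)
  also have "\<dots> = real (2 * g (coroot w))"
    using relation b by simp
  finally show ?thesis
    by (simp only: of_nat_eq_iff)
qed

text \<open>A splitting into orthogonal parts splits the relation into two sums, each of which
  vanishes because they are orthogonal and opposite. The part without \<alpha> would then be a
  positive relation between independent simple roots.\<close>

lemma cartan_connected:
  assumes "S \<subseteq> V" "S \<noteq> {}" and closed: "\<And>u w. u \<in> V \<Longrightarrow> w \<in> S \<Longrightarrow> cartan u w \<noteq> 0 \<Longrightarrow> u \<in> S"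
  shows "S = V"
proof (rule ccontr)
  assume "S \<noteq> V"
  define B C where "B = {a \<in> E. coroot a \<in> S}" and "C = {a \<in> E. coroot a \<notin> S}"
  define s t where "s = (\<Sum>a\<in>B. real (g a) *\<^sub>R coroot a)" and "t = (\<Sum>a\<in>C. real (g a) *\<^sub>R coroot a)"
  have BC: "B \<noteq> {}" "C \<noteq> {}" "B \<union> C = E" "B \<inter> C = {}"
    using assms(1,2) \<open>S \<noteq> V\<close> by (auto simp: B_def C_def)
  have "s + t = 0"
    unfolding s_def t_def using relation BC finite_E
    by (subst sum.union_disjoint [symmetric]) (auto intro: finite_subset)
  moreover have "s \<bullet> t = 0"
  proof -
    have "coroot a \<bullet> coroot b = 0" if "a \<in> B" "b \<in> C" for a b
      using that closed [of "coroot b" "coroot a"] cartan_eq_0_iff [of "coroot b" "coroot a"]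
      by (auto simp: B_def C_def inner_commute)
    then show ?thesis
      by (simp add: s_def t_def inner_sum_left inner_sum_right)
  qed
  ultimately have "s = - t" "s \<bullet> s = 0"
    by (simp_all add: eq_neg_iff_add_eq_0) (simp add: add_eq_0_iff)
  then have "s = 0" "t = 0"
    by simp_all
  moreover have "(\<Sum>a\<in>T. real (g a) *\<^sub>R coroot a) \<noteq> 0" if T: "T \<subseteq> \<Delta>" "T \<noteq> {}" for T
  proof -
    have "(\<Sum>a\<in>T. real (g a) *\<^sub>R coroot a) = (\<Sum>a\<in>T. (real (g a) * (2 / (a \<bullet> a))) *\<^sub>R a)"
      by (simp add: coroot_def)
    also have "\<dots> \<noteq> 0"
      using T g_pos E_nonzero
      by (intro independent_no_positive_relation [OF independent T]) (auto simp: E subset_iff)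
    finally show ?thesis .
  qed
  moreover have "B \<subseteq> \<Delta> \<or> C \<subseteq> \<Delta>"
    unfolding B_def C_def E by (cases "coroot \<alpha> \<in> S") blast+
  ultimately show False
    using BC by (auto simp: s_def t_def)
qed

sublocale harmonic_graph V cartan "\<lambda>u. g (coroot u)"
proof
  show "Gcd ((\<lambda>u. g (coroot u)) ` V) = 1"
    using Gcd_g by (simp add: image_image)
  show "cartan u w = 0 \<longleftrightarrow> cartan w u = 0" if "u \<in> V" "w \<in> V" for u w
    using that by (auto simp: cartan_eq_0_iff inner_commute)
qed (use finite_E g_pos cartan_harmonic cartan_connected in auto)

text \<open>Both \<open>cartan u w * (w \<bullet> w)\<close> and
  \<open>cartan w u * (u \<bullet> u)\<close> equal -2 (u, w).\<close>

lemma cartan_less_norm: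
  assumes "u \<in> V" "w \<in> V" "cartan u w < cartan w u"
  shows "norm u < norm w"
proof -
  have ne: "u \<noteq> w"
    using assms(3) by auto
  have "real (cartan u w) * (w \<bullet> w) = real (cartan w u) * (u \<bullet> u)"
    using cartan_inner [OF assms(1,2) ne] cartan_inner [OF assms(2,1)] ne by (simp add: inner_commute)
  moreover have "real (cartan u w) * (u \<bullet> u) < real (cartan w u) * (u \<bullet> u)"
    using assms V_nonzero by (intro mult_strict_right_mono) auto
  ultimately have "real (cartan u w) * (u \<bullet> u) < real (cartan u w) * (w \<bullet> w)"
    by simp
  then have "u \<bullet> u < w \<bullet> w"
    by (metis mult_le_cancel_left1 mult_less_cancel_left_disj of_nat_less_0_iff)
  then show ?thesis
    by (simp add: norm_eq_sqrt_inner)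
qed

lemma graph_diagram_coroots:
  "graph_diagram V cartan (\<lambda>u. g (coroot u)) (coroot_diagram E)
    (subdiagram (coroot_diagram E) {u \<in> V. \<not> k dvd g (coroot u)}) k"
proof unfold_locales
  show "bonds (coroot_diagram E) u w = {#} \<longleftrightarrow> cartan u w = 0" if "u \<in> V" "w \<in> V" for u w
    using that by (auto simp: coroot_diagram_def cartan_eq_0_iff)
next
  fix u w assume V: "u \<in> V" "w \<in> V" and c: "cartan u w = 1" "cartan w u = 1"
  have ne: "u \<noteq> w" "u \<bullet> w \<noteq> 0"
    using c(1) cartan_eq_0_iff [OF V] by auto
  have *: "w \<bullet> w = - 2 * (u \<bullet> w)" "u \<bullet> u = - 2 * (u \<bullet> w)"
    using cartan_inner [OF V ne(1)] cartan_inner [OF V(2,1)] ne(1) c by (auto simp: inner_commute)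
  then have norm: "norm u = norm w"
    by (simp add: norm_eq_sqrt_inner)
  \<comment> \<open>This rules out the diagram with two bonds: opposite nodes have weights 2, not
    1.\<close>
  have "w \<noteq> - u"
  proof
    assume "w = - u"
    then have "u \<bullet> u = 0"
      using *(2) by simp
    then show False
      using V_nonzero [OF V(1)] by simp
  qed
  then have "V \<noteq> {u, - u}"
    using V(2) ne(1) by (metis insertE singletonD)
  then show "bonds (coroot_diagram E) u w = {#1#}"
    using V ne norm V_nonzero by (simp add: coroot_diagram_def)
qed (auto simp: coroot_diagram_def)

text \<open>If a were not longer with respect to l, the bond, whose multiplicity is not 1, would
  need an arrow toward a. But arrows point toward the smaller norm.\<close>

lemma length_function_less:
  assumes l: "length_function (coroot_diagram E) l"
    and "v \<in> V" "a \<in> nb v" "cartan v a < cartan a v"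
  shows "l v < l a"
proof (rule ccontr)
  assume "\<not> l v < l a"
  then have le: "l a \<le> l v" by simp
  have a: "a \<in> V" "v \<bullet> a \<noteq> 0" "v \<noteq> a"
    using assms(2,3) cartan_eq_0_iff [of a v] by (auto simp: nb_def inner_commute)
  have norm: "norm v < norm a"
    using assms a by (intro cartan_less_norm)
  have "V \<noteq> {v, - v}"
    using norm a by auto
  then have "(norm a)\<^sup>2 / (norm v)\<^sup>2 \<in># bonds (coroot_diagram E) v a"
    using assms(2) a norm by (simp add: coroot_diagram_def max_def min_def)
  moreover have "(norm a)\<^sup>2 / (norm v)\<^sup>2 \<noteq> 1"
    using norm V_nonzero [OF assms(2)] by (auto simp: divide_eq_1_iff)
  moreover have "v \<in> nodes (coroot_diagram E)" "a \<in> nodes (coroot_diagram E)"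
    using assms(2) a(1) by (simp_all add: coroot_diagram_def)
  ultimately have "arrow (coroot_diagram E) v a"
    using l le unfolding length_function_def by blast
  then show False
    using norm by (simp add: coroot_diagram_def)
qed

end

lemma dvd_mult_iff_reduced:
  fixes k m x :: nat
  assumes "0 < k"
  shows "k dvd m * x \<longleftrightarrow> k div gcd k m dvd x"
proof -
  define d where "d = gcd k m"
  obtain k' m' where k: "k = d * k'" and m: "m = d * m'"
    unfolding d_def by (meson dvd_def gcd_dvd1 gcd_dvd2)
  have d: "0 < d"
    using assms by (simp add: d_def)
  have "coprime k' m'"
    using div_gcd_coprime [of k m] assms d unfolding d_def [symmetric] by (simp add: k m)
  then have "d * k' dvd d * (m' * x) \<longleftrightarrow> k' dvd x"
    using d by (simp add: coprime_dvd_mult_right_iff)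
  moreover have "k div d = k'"
    using k d by simp
  ultimately show ?thesis
    using k m unfolding d_def [symmetric] by (simp add: mult.assoc)
qed

theorem proposition1p7p1:
  fixes \<Psi> \<Delta> E :: "'a::euclidean_space set"
    and \<alpha> v :: 'a
    and g n :: "'a \<Rightarrow> nat"
    and n0 k :: nat
    and D D' :: "'a diagram"
    and \<l> :: "'a \<Rightarrow> real"
  assumes "irreducible_root_system \<Psi>"
    and "simple_roots \<Psi> \<Delta>"
    and "highest_root \<Psi> \<Delta> (- \<alpha>)"
    and "E = insert \<alpha> \<Delta>"
    and "D = coroot_diagram E"
    and "coroot_integers E g"
    and "0 < n0"
    and "\<forall>a\<in>E. n a = n0 * g a"
    and "1 \<le> k"
    and "\<exists>a\<in>E. k dvd n a"
    and "D' = subdiagram D (coroot ` I_tilde E n k)"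
    and "length_function D \<l>"
    and "v \<in> coroot ` E - coroot ` I_tilde E n k"
  shows "exactly_one
    [type_infinity D D' v,
     type_1 D D' v,
     type_2i D D' \<l> v,
     type_2ii D D' \<l> v,
     type_3 D D' v,
     type_4 D D' \<l> v]"
proof -
  define k' where "k' = k div gcd k n0"
  have dvd: "k dvd n a \<longleftrightarrow> k' dvd g a" if "a \<in> E" for a
    using assms(8,9) that dvd_mult_iff_reduced [of k n0 "g a"] by (simp add: k'_def)
  have "gcd k n0 \<le> k"
    using assms(9) by (intro dvd_imp_le) auto
  then have k': "1 \<le> k'"
    using assms(9) by (simp add: k'_def Suc_le_eq div_greater_zero_iff)
  interpret extended_simple_roots \<Psi> \<Delta> E \<alpha> g
    using assms(1-4,6) by unfold_locales (auto simp: irreducible_root_system_def)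
  have I: "coroot ` I_tilde E n k = {u \<in> V. \<not> k' dvd g (coroot u)}"
    using dvd by (auto simp: I_tilde_def)
  interpret graph_diagram V cartan "\<lambda>u. g (coroot u)" D D' k'
    using graph_diagram_coroots [of k'] by (simp add: assms(5,11) I)
  have v: "v \<in> V" "k' dvd g (coroot v)"
    using assms(13) unfolding I by auto
  show ?thesis
  proof (rule types_exactly_one [OF joined_D'_sym])
    show "type_infinity D D' v \<or> type_1 D D' v \<or> type_2i D D' \<l> v \<or> type_2ii D D' \<l> v \<or>
        type_3 D D' v \<or> type_4 D D' \<l> v"
      using v k' length_function_less [OF _ v(1)] assms(5,12) by (intro some_type) auto
  qed
qed

end
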